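(* Every near-action of a Polish non-archimedean group admits a spatial model.
   Context: A topological group is non-archimedean if it has a neighborhood basis at the identity consisting of open subgroups. Let $G$ be a Polish group and $(X,\mathcal{X},\mu)$ a standard Borel space with a probability measure. A near-action of $G$ on $(X,\mathcal{X},\mu)$ is a Borel map $G\times X\to X$, $(g,x)\mapsto gx$, such that: (i) $ex=x$ for almost every $x$; (ii) for each pair $g,h\in G$, $g(hx)=(gh)x$ for almost every $x$ (the exceptional null set may depend on $g,h$); (iii) each $g\in G$ preserves $\mu$. Equivalently, a near-action is a continuous homomorphism from $G$ to $\mathrm{Aut}(X,\mathcal{X},\mu)$, the Polish group of invertible measure preserving transformations modulo null sets, with the topology whose neighborhoods of the identity are generated by the sets $\{T:\mu(A\triangle TA)<\varepsilon\}$, $A\in\mathcal{X}$, $\varepsilon>0$. A spatial $G$-action is a Borel map $G\times Y\to Y$ on a standard Borel probability space $Y$ with $ey=y$ and $g(hy)=(gh)y$ for all $g,h\in G$ and all $y\in Y$, each $g$ preserving the measure. A near-action admits a spatial model if its induced action on the measure algebra (measurable sets modulo null sets) is isomorphic to the one induced by some spatial $G$-action. *)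

theory Defs
  imports "HOL-Probability.Probability" "HOL-Algebra.Group"
begin

section \<open>Polish groups\<close>

definition polish_topology :: "'a topology \<Rightarrow> bool" where
  "polish_topology T \<longleftrightarrow> completely_metrizable_space T \<and> separable_space T"

definition borel_of :: "'a topology \<Rightarrow> 'a measure" where
  "borel_of T = sigma (topspace T) {U. openin T U}"

locale polish_group = group G for G :: "('g, 'm) monoid_scheme" (structure) +
  fixes T :: "'g topology"
  assumes topspace_eq: "topspace T = carrier G"
    and continuous_mult: "continuous_map (prod_topology T T) T (\<lambda>(g, h). g \<otimes> h)"
    and continuous_inv: "continuous_map T T (\<lambda>g. inv g)"
    and polish: "polish_topology T"

definition non_archimedean :: "('g, 'm) monoid_scheme \<Rightarrow> 'g topology \<Rightarrow> bool" where
  "non_archimedean G T \<longleftrightarrow>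
     neighbourhood_base_at \<one>\<^bsub>G\<^esub> (\<lambda>H. subgroup H G \<and> openin T H) T"


section \<open>Near-actions and spatial actions\<close>

text \<open>
  Both topologies involved are second countable, so the product sigma-algebra used for the
  joint measurability of an action is the Borel algebra of the product space.
\<close>

definition standard_borel :: "'a measure \<Rightarrow> bool" where
  "standard_borel M \<longleftrightarrow>
     (\<exists>S. polish_topology S \<and> topspace S = space M \<and> sets M = sets (borel_of S))"

locale standard_borel_prob_space = prob_space M for M :: "'a measure" +
  assumes standard_borel: "standard_borel M"

locale near_action =
  polish_group G T + standard_borel_prob_space M
  for G :: "('g, 'm) monoid_scheme" (structure) and T :: "'g topology" and M :: "'a measure" +
  fixes act :: "'g \<Rightarrow> 'a \<Rightarrow> 'a"
  assumes borel_act: "(\<lambda>(g, x). act g x) \<in> borel_of T \<Otimes>\<^sub>M M \<rightarrow>\<^sub>M M"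
    and AE_act_one: "AE x in M. act \<one> x = x"
    and AE_act_mult:
      "\<And>g h. g \<in> carrier G \<Longrightarrow> h \<in> carrier G \<Longrightarrow> AE x in M. act g (act h x) = act (g \<otimes> h) x"
    and act_preserves: "\<And>g. g \<in> carrier G \<Longrightarrow> distr M M (act g) = M"

locale spatial_action =
  polish_group G T + standard_borel_prob_space M
  for G :: "('g, 'm) monoid_scheme" (structure) and T :: "'g topology" and M :: "'a measure" +
  fixes act :: "'g \<Rightarrow> 'a \<Rightarrow> 'a"
  assumes borel_act: "(\<lambda>(g, x). act g x) \<in> borel_of T \<Otimes>\<^sub>M M \<rightarrow>\<^sub>M M"
    and act_one: "\<And>x. x \<in> space M \<Longrightarrow> act \<one> x = x"
    and act_mult:
      "\<And>g h x. g \<in> carrier G \<Longrightarrow> h \<in> carrier G \<Longrightarrow> x \<in> space M \<Longrightarrow>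
         act g (act h x) = act (g \<otimes> h) x"
    and act_preserves: "\<And>g. g \<in> carrier G \<Longrightarrow> distr M M (act g) = M"


section \<open>The measure algebra\<close>

definition null_rel :: "'a measure \<Rightarrow> ('a set \<times> 'a set) set" where
  "null_rel M = {(A, B). A \<in> sets M \<and> B \<in> sets M \<and> sym_diff A B \<in> null_sets M}"

definition malg :: "'a measure \<Rightarrow> 'a set set set" where
  "malg M = sets M // null_rel M"

text \<open>
  The operations on classes are unions over all representatives, in the style of
  the theory Equiv_Relations; the lemmas below evaluate them on a single representative.
\<close>

definition malg_inf :: "'a measure \<Rightarrow> 'a set set \<Rightarrow> 'a set set \<Rightarrow> 'a set set" where
  "malg_inf M a b = (\<Union>A\<in>a. \<Union>B\<in>b. null_rel M `` {A \<inter> B})"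

definition malg_compl :: "'a measure \<Rightarrow> 'a set set \<Rightarrow> 'a set set" where
  "malg_compl M a = (\<Union>A\<in>a. null_rel M `` {space M - A})"

definition malg_measure :: "'a measure \<Rightarrow> 'a set set \<Rightarrow> ennreal" where
  "malg_measure M a = the_elem (emeasure M ` a)"

text \<open>
  The class of \<open>gA\<close>. For a near-action the image of \<open>A\<close> under \<open>act g\<close> need not be measurable,
  so \<open>gA\<close> is taken to be the preimage of \<open>A\<close> under the inverse of \<open>g\<close>; for a spatial action
  this is the image.
\<close>

definition malg_act ::
  "('g, 'm) monoid_scheme \<Rightarrow> 'a measure \<Rightarrow> ('g \<Rightarrow> 'a \<Rightarrow> 'a) \<Rightarrow> 'g \<Rightarrow> 'a set set \<Rightarrow> 'a set set" where
  "malg_act G M act g a = (\<Union>A\<in>a. null_rel M `` {act (inv\<^bsub>G\<^esub> g) -` A \<inter> space M})"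

text \<open>
  An isomorphism of Boolean algebras preserves all existing suprema, so countable operations
  need not be mentioned.
\<close>

definition malg_iso :: "'a measure \<Rightarrow> 'b measure \<Rightarrow> ('a set set \<Rightarrow> 'b set set) \<Rightarrow> bool" where
  "malg_iso M N \<Phi> \<longleftrightarrow>
     bij_betw \<Phi> (malg M) (malg N) \<and>
     (\<forall>a\<in>malg M. \<forall>b\<in>malg M. \<Phi> (malg_inf M a b) = malg_inf N (\<Phi> a) (\<Phi> b)) \<and>
     (\<forall>a\<in>malg M. \<Phi> (malg_compl M a) = malg_compl N (\<Phi> a)) \<and>
     (\<forall>a\<in>malg M. malg_measure N (\<Phi> a) = malg_measure M a)"

definition malg_actions_isomorphic ::
  "('g, 'm) monoid_scheme \<Rightarrow> 'a measure \<Rightarrow> ('g \<Rightarrow> 'a \<Rightarrow> 'a) \<Rightarrow> 'b measure \<Rightarrow> ('g \<Rightarrow> 'b \<Rightarrow> 'b) \<Rightarrow> bool"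
  where
  "malg_actions_isomorphic G M act N act' \<longleftrightarrow>
     (\<exists>\<Phi>. malg_iso M N \<Phi> \<and>
          (\<forall>g\<in>carrier G. \<forall>a\<in>malg M. \<Phi> (malg_act G M act g a) = malg_act G N act' g (\<Phi> a)))"

text \<open>
  HOL cannot quantify over the type of points of the model. Fixing it to \<^typ>\<open>nat \<Rightarrow> bool\<close> loses
  nothing: this type has the cardinality of the continuum, a standard Borel space has at most
  that many points, and \<^const>\<open>standard_borel\<close> refers to an arbitrary Polish topology on the
  carrier (not to the topology of the type), so every spatial action can be transported along
  an injection of its space into this type.
\<close>

definition admits_spatial_model ::
  "('g, 'm) monoid_scheme \<Rightarrow> 'g topology \<Rightarrow> 'a measure \<Rightarrow> ('g \<Rightarrow> 'a \<Rightarrow> 'a) \<Rightarrow> bool" where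
  "admits_spatial_model G T M act \<longleftrightarrow>
     (\<exists>(N :: (nat \<Rightarrow> bool) measure) act'.
        spatial_action G T N act' \<and> malg_actions_isomorphic G M act N act')"


subsection \<open>Well-definedness\<close>

lemma null_rel_iff_AE:
  "(A, B) \<in> null_rel M \<longleftrightarrow> A \<in> sets M \<and> B \<in> sets M \<and> (AE x in M. x \<in> A \<longleftrightarrow> x \<in> B)"
proof (cases "A \<in> sets M \<and> B \<in> sets M")
  case True
  then have "sym_diff A B \<in> null_sets M \<longleftrightarrow> (AE x in M. x \<notin> sym_diff A B)"
    by (intro AE_iff_null_sets) auto
  also have "\<dots> \<longleftrightarrow> (AE x in M. x \<in> A \<longleftrightarrow> x \<in> B)"
    by (rule AE_cong) auto
  finally show ?thesis
    using True by (simp add: null_rel_def)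
qed (auto simp: null_rel_def)

lemma equiv_null_rel: "equiv (sets M) (null_rel M)"
proof (rule equivI)
  show "null_rel M \<subseteq> sets M \<times> sets M"
    by (auto simp: null_rel_def)
  show "refl_on (sets M) (null_rel M)"
    by (auto simp: refl_on_def null_rel_def)
  show "sym (null_rel M)"
    by (auto simp: sym_def null_rel_def Un_commute)
  show "trans (null_rel M)"
  proof (rule transI)
    fix A B C assume 1: "(A, B) \<in> null_rel M" "(B, C) \<in> null_rel M"
    then have "AE x in M. x \<in> A \<longleftrightarrow> x \<in> B" "AE x in M. x \<in> B \<longleftrightarrow> x \<in> C"
      by (auto simp: null_rel_iff_AE)
    then have "AE x in M. x \<in> A \<longleftrightarrow> x \<in> C"
      by eventually_elim auto
    with 1 show "(A, C) \<in> null_rel M"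
      by (auto simp: null_rel_iff_AE)
  qed
qed

lemma malg_inf_class:
  assumes "A \<in> sets M" "B \<in> sets M"
  shows "malg_inf M (null_rel M `` {A}) (null_rel M `` {B}) = null_rel M `` {A \<inter> B}"
proof -
  have "congruent2 (null_rel M) (null_rel M) (\<lambda>A B. null_rel M `` {A \<inter> B})"
  proof (rule congruent2I')
    fix A A' B B' assume 1: "(A, A') \<in> null_rel M" "(B, B') \<in> null_rel M"
    then have "AE x in M. x \<in> A \<longleftrightarrow> x \<in> A'" "AE x in M. x \<in> B \<longleftrightarrow> x \<in> B'"
      by (auto simp: null_rel_iff_AE)
    then have "AE x in M. x \<in> A \<inter> B \<longleftrightarrow> x \<in> A' \<inter> B'"
      by eventually_elim auto
    with 1 have "(A \<inter> B, A' \<inter> B') \<in> null_rel M"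
      by (auto simp: null_rel_iff_AE)
    then show "null_rel M `` {A \<inter> B} = null_rel M `` {A' \<inter> B'}"
      by (rule equiv_class_eq[OF equiv_null_rel])
  qed
  from UN_equiv_class2[OF equiv_null_rel equiv_null_rel this assms] show ?thesis
    by (simp add: malg_inf_def)
qed

lemma malg_compl_class:
  assumes "A \<in> sets M"
  shows "malg_compl M (null_rel M `` {A}) = null_rel M `` {space M - A}"
proof -
  have "(\<lambda>A. null_rel M `` {space M - A}) respects null_rel M"
  proof (rule congruentI)
    fix A A' assume 1: "(A, A') \<in> null_rel M"
    then have "AE x in M. x \<in> A \<longleftrightarrow> x \<in> A'"
      by (auto simp: null_rel_iff_AE)
    then have "AE x in M. x \<in> space M - A \<longleftrightarrow> x \<in> space M - A'"
      by eventually_elim auto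
    with 1 have "(space M - A, space M - A') \<in> null_rel M"
      by (auto simp: null_rel_iff_AE)
    then show "null_rel M `` {space M - A} = null_rel M `` {space M - A'}"
      by (rule equiv_class_eq[OF equiv_null_rel])
  qed
  from UN_equiv_class[OF equiv_null_rel this assms] show ?thesis
    by (simp add: malg_compl_def)
qed

lemma malg_measure_class:
  assumes "A \<in> sets M"
  shows "malg_measure M (null_rel M `` {A}) = emeasure M A"
proof -
  have "emeasure M B = emeasure M A" if "B \<in> null_rel M `` {A}" for B
    using that by (intro emeasure_eq_AE) (auto simp: null_rel_iff_AE)
  moreover have "A \<in> null_rel M `` {A}"
    using assms by (rule equiv_class_self[OF equiv_null_rel])
  ultimately have "emeasure M ` (null_rel M `` {A}) = {emeasure M A}"
    by blast
  then show ?thesis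
    by (simp add: malg_measure_def)
qed

lemma measurable_section:
  assumes "(\<lambda>(g, x). act g x) \<in> borel_of T \<Otimes>\<^sub>M M \<rightarrow>\<^sub>M M" "g \<in> topspace T"
  shows "act g \<in> M \<rightarrow>\<^sub>M M"
proof -
  have "g \<in> space (borel_of T)"
    using assms(2) by (simp add: borel_of_def space_measure_of_conv)
  from measurable_Pair2[OF assms(1) this] show ?thesis
    by simp
qed

lemma malg_act_class_aux:
  assumes f: "f \<in> M \<rightarrow>\<^sub>M M" and pres: "distr M M f = M" and A: "A \<in> sets M"
  shows "(\<Union>A\<in>null_rel M `` {A}. null_rel M `` {f -` A \<inter> space M}) =
         null_rel M `` {f -` A \<inter> space M}"
proof -
  have "(\<lambda>A. null_rel M `` {f -` A \<inter> space M}) respects null_rel M"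
  proof (rule congruentI)
    fix A A' assume 1: "(A, A') \<in> null_rel M"
    then have "AE x in distr M M f. x \<in> A \<longleftrightarrow> x \<in> A'"
      unfolding pres by (simp add: null_rel_iff_AE)
    then have "AE x in M. f x \<in> A \<longleftrightarrow> f x \<in> A'"
      using 1 f by (subst (asm) AE_distr_iff) (auto simp: null_rel_iff_AE)
    then have "AE x in M. x \<in> f -` A \<inter> space M \<longleftrightarrow> x \<in> f -` A' \<inter> space M"
      by eventually_elim auto
    with 1 f have "(f -` A \<inter> space M, f -` A' \<inter> space M) \<in> null_rel M"
      by (auto simp: null_rel_iff_AE)
    then show "null_rel M `` {f -` A \<inter> space M} = null_rel M `` {f -` A' \<inter> space M}"
      by (rule equiv_class_eq[OF equiv_null_rel])
  qed
  from UN_equiv_class[OF equiv_null_rel this A] show ?thesis .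
qed

lemma (in near_action) malg_act_class:
  assumes "g \<in> carrier G" "A \<in> sets M"
  shows "malg_act G M act g (null_rel M `` {A}) =
         null_rel M `` {act (inv g) -` A \<inter> space M}"
  unfolding malg_act_def
  using assms borel_act
  by (intro malg_act_class_aux act_preserves measurable_section[of act T]) (auto simp: topspace_eq)

lemma (in spatial_action) near_action: "near_action G T M act"
  by unfold_locales (use borel_act act_preserves in \<open>auto simp: act_one act_mult\<close>)

lemma (in spatial_action) vimage_inv_eq_image:
  assumes g: "g \<in> carrier G" and A: "A \<in> sets M"
  shows "act (inv g) -` A \<inter> space M = act g ` A"
proof (intro equalityI subsetI)
  have sp: "act h x \<in> space M" if "h \<in> carrier G" "x \<in> space M" for h x
    using measurable_space[OF measurable_section[OF borel_act]] that by (auto simp: topspace_eq)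
  fix x
  show "x \<in> act g ` A" if "x \<in> act (inv g) -` A \<inter> space M"
    using that g act_mult[of g "inv g" x] by (auto simp: act_one image_iff intro!: bexI[of _ "act (inv g) x"])
  show "x \<in> act (inv g) -` A \<inter> space M" if "x \<in> act g ` A"
    using that g sets.sets_into_space[OF A] by (auto simp: act_mult act_one subset_eq intro!: sp)
qed

end

theory Submission
  imports Defs "HOL-Library.Countable"
begin

text \<open>
  Write \<open>A\<^bsub>g\<^esub>\<close> for the preimage of a measurable set \<open>A\<close> under \<open>g\<close>. The difficulty with a
  near-action is that each of its identities fails on a null set depending on the group
  elements, and there are uncountably many of these. In a non-archimedean group this
  disappears, because enough of the measure algebra is seen by \<open>G\<close> only through countable
  discrete coset spaces.

  Call a class in the measure algebra smooth if it is fixed by an open subgroup. Its orbit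
  is then countable, as \<open>G\<close> is separable and the cosets of the open stabiliser are open. Suppose a
  countable \<open>G\<close>-invariant set \<open>B\<close> of smooth classes is dense in the measure algebra. Choose a
  representative of each class in \<open>B\<close> and map a point to the set of those representatives that
  contain it. This is a measurable map into the Cantor space \<open>2\<^sup>B\<close>, on which \<open>G\<close> acts by permuting
  coordinates. Permutations obey the group law everywhere, and the open stabilisers make the
  action Borel. Since \<open>B\<close> is countable, the coding map is equivariant up to a null set for each
  \<open>g\<close>, so the image measure is invariant. Density of \<open>B\<close> and the Borel--Cantelli lemma show that
  every measurable set is, up to a null set, the preimage of a Borel set of codes. Hence the
  measure algebras and their actions agree (\<open>spatial_model_of_coding\<close>). Using the full
  product \<open>2\<^sup>B\<close> with an image measure avoids Stone spaces and extension theorems for measures.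

  It remains to approximate a measurable set \<open>A\<close> by smooth ones, which takes two steps. A
  Pettis-type Baire category argument gives an open subgroup \<open>H\<close> all of whose elements
  displace \<open>A\<close> by little (\<open>open_subgroup_small_displacement\<close>). Then there is an \<open>H\<close>-invariant
  set near \<open>A\<close> (\<open>invariant_approximation\<close>). As \<open>H\<close> need not carry an invariant measure,
  averaging over \<open>H\<close> is replaced by minimising the \<open>L\<^sup>2\<close> norm over a closed convex
  \<open>H\<close>-invariant set of functions near the indicator of \<open>A\<close>: the minimiser is unique, hence
  invariant, and its level sets are invariant sets.
\<close>

section \<open>Approximation of measurable sets\<close>

lemma (in finite_measure) measure_sym_diff_triangle:
  assumes [measurable]: "A \<in> sets M" "B \<in> sets M" "C \<in> sets M"
  shows "measure M (sym_diff A C) \<le> measure M (sym_diff A B) + measure M (sym_diff B C)"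
proof -
  have "measure M (sym_diff A C) \<le> measure M (sym_diff A B \<union> sym_diff B C)"
    by (rule finite_measure_mono) auto
  also have "\<dots> \<le> measure M (sym_diff A B) + measure M (sym_diff B C)"
    by (rule measure_Un_le) auto
  finally show ?thesis .
qed

lemma (in finite_measure) measure_sym_diff_cong:
  assumes "AE x in M. x \<in> A \<longleftrightarrow> x \<in> A'" "A \<in> sets M" "A' \<in> sets M" "B \<in> sets M"
  shows "measure M (sym_diff A B) = measure M (sym_diff A' B)"
proof (rule measure_eq_AE)
  show "AE x in M. x \<in> sym_diff A B \<longleftrightarrow> x \<in> sym_diff A' B"
    using assms(1) by eventually_elim auto
qed (use assms in auto)

text \<open>
  Terms for the algebra of sets generated by a sequence. Indexing this algebra by a
  countable type makes its countability immediate.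
\<close>

datatype set_term = Gen nat | Compl set_term | Join set_term set_term

instance set_term :: countable
  by countable_datatype

primrec eval_term :: "'a set \<Rightarrow> (nat \<Rightarrow> 'a set) \<Rightarrow> set_term \<Rightarrow> 'a set" where
  "eval_term \<Omega> E (Gen n) = E n"
| "eval_term \<Omega> E (Compl s) = \<Omega> - eval_term \<Omega> E s"
| "eval_term \<Omega> E (Join s t) = eval_term \<Omega> E s \<union> eval_term \<Omega> E t"

text \<open>
  The sets that can be approximated by members of the generated algebra form a
  \<open>\<sigma>\<close>-algebra: a countable union is approximated by its finite subunions.
\<close>

lemma (in finite_measure) countably_generated_imp_separable:
  fixes E :: "nat \<Rightarrow> 'a set"
  assumes gen: "sets M = sigma_sets (space M) (range E)"
  obtains D :: "nat \<Rightarrow> 'a set" where "range D \<subseteq> sets M"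
    "\<And>A e. A \<in> sets M \<Longrightarrow> e > 0 \<Longrightarrow> \<exists>n. measure M (sym_diff A (D n)) < e"
proof -
  define ev where "ev = eval_term (space M) E"
  have ev_sets [measurable]: "ev t \<in> sets M" for t
  proof -
    have "E n \<in> sets M" for n by (auto simp: gen)
    then show ?thesis unfolding ev_def by (induction t) auto
  qed
  have approx: "A \<in> sets M \<and> (\<forall>e>0. \<exists>t. measure M (sym_diff A (ev t)) < e)"
    if "A \<in> sigma_sets (space M) (range E)" for A
    using that
  proof induction
    case (Basic A)
    then obtain n where n: "A = E n" by auto
    have "measure M (sym_diff A (ev (Gen n))) = 0"
      by (simp add: n ev_def)
    moreover have "A \<in> sets M" using n by (auto simp: gen)
    ultimately show ?case
      by (metis)
  next
    case Empty
    \<comment> \<open>the term language has no constant for the empty set; a complement of a tautology denotes it\<close>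
    have "ev (Compl (Join (Gen 0) (Compl (Gen 0)))) = {}"
      by (auto simp: ev_def)
    then show ?case by (metis Diff_empty Un_empty_left measure_empty sets.empty_sets)
  next
    case (Compl A)
    then have A: "A \<in> sets M" by auto
    have "sym_diff (space M - A) (ev (set_term.Compl t)) = sym_diff A (ev t)" for t
      using sets.sets_into_space[OF A] sets.sets_into_space[OF ev_sets[of t]] by (auto simp: ev_def)
    then show ?case using A Compl.IH by (metis sets.compl_sets)
  next
    case (Union A)
    then have A [measurable]: "A i \<in> sets M" for i by auto
    have fin: "\<exists>t. measure M (sym_diff (\<Union>i<N. A i) (ev t)) < e" if "e > 0" for N :: nat and e :: real
      using that
    proof (induction N arbitrary: e)
      case 0
      have "ev (Compl (Join (Gen 0) (Compl (Gen 0)))) = {}"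
        by (auto simp: ev_def)
      then show ?case using 0
        by (intro exI[of _ "Compl (Join (Gen 0) (Compl (Gen 0)))"]) simp
    next
      case (Suc N)
      obtain t where t: "measure M (sym_diff (\<Union>i<N. A i) (ev t)) < e/2"
        using Suc.IH[of "e/2"] Suc.prems by auto
      obtain s where s: "measure M (sym_diff (A N) (ev s)) < e/2"
        using Union.IH[of N] Suc.prems half_gt_zero by blast
      have "measure M (sym_diff (\<Union>i<Suc N. A i) (ev (Join t s)))
        \<le> measure M (sym_diff (\<Union>i<N. A i) (ev t) \<union> sym_diff (A N) (ev s))"
      proof (rule finite_measure_mono)
        show "sym_diff (\<Union>i<Suc N. A i) (ev (Join t s))
            \<subseteq> sym_diff (\<Union>i<N. A i) (ev t) \<union> sym_diff (A N) (ev s)"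
          by (auto simp: ev_def less_Suc_eq)
      qed measurable
      also have "\<dots> \<le> measure M (sym_diff (\<Union>i<N. A i) (ev t)) + measure M (sym_diff (A N) (ev s))"
        by (rule measure_Un_le) auto
      finally show ?case using s t by (intro exI[of _ "Join t s"]) linarith
    qed
    have "\<exists>t. measure M (sym_diff (\<Union>i. A i) (ev t)) < e" if "e > 0" for e :: real
    proof -
      have "(\<lambda>N. measure M (\<Union>i<N. A i)) \<longlonglongrightarrow> measure M (\<Union>N. \<Union>i<N. A i)"
        by (rule finite_Lim_measure_incseq) (auto simp: incseq_def intro: less_le_trans)
      also have "(\<Union>N. \<Union>i<N. A i) = (\<Union>i. A i)"
        by auto
      finally have "\<forall>\<^sub>F N in sequentially. dist (measure M (\<Union>i<N. A i)) (measure M (\<Union>i. A i)) < e/2"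
        using tendstoD \<open>e > 0\<close> half_gt_zero by blast
      then obtain N where N: "\<bar>measure M (\<Union>i<N. A i) - measure M (\<Union>i. A i)\<bar> < e/2"
        by (auto simp: eventually_sequentially dist_real_def)
      have "sym_diff (\<Union>i. A i) (\<Union>i<N. A i) = (\<Union>i. A i) - (\<Union>i<N. A i)"
        by auto
      moreover have "measure M ((\<Union>i. A i) - (\<Union>i<N. A i)) = measure M (\<Union>i. A i) - measure M (\<Union>i<N. A i)"
        by (rule finite_measure_Diff) auto
      ultimately have 1: "measure M (sym_diff (\<Union>i. A i) (\<Union>i<N. A i)) < e/2"
        using N by (simp only: abs_less_iff) linarith
      obtain t where 2: "measure M (sym_diff (\<Union>i<N. A i) (ev t)) < e/2"
        using fin[of "e/2" N] \<open>e > 0\<close> by auto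
      have "measure M (sym_diff (\<Union>i. A i) (ev t)) \<le>
        measure M (sym_diff (\<Union>i. A i) (\<Union>i<N. A i)) + measure M (sym_diff (\<Union>i<N. A i) (ev t))"
        by (rule measure_sym_diff_triangle) auto
      then show ?thesis using 1 2 by (intro exI[of _ t]) linarith
    qed
    then show ?case by auto
  qed
  show thesis
  proof (rule that[of "\<lambda>n. ev (from_nat n)"])
    show "range (\<lambda>n. ev (from_nat n)) \<subseteq> sets M" by auto
    show "\<exists>n. measure M (sym_diff A (ev (from_nat n))) < e" if "A \<in> sets M" "e > 0" for A e
      using approx[of A] that unfolding gen by (metis from_nat_to_nat)
  qed
qed

lemma polish_topology_second_countable:
  assumes "polish_topology S"
  shows "second_countable S"
proof -
  have "metrizable_space S" and sep: "separable_space S"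
    using assms completely_metrizable_imp_metrizable_space by (auto simp: polish_topology_def)
  then obtain X d where M: "Metric_space X d" and S: "S = Metric_space.mtopology X d"
    by (auto simp: metrizable_space_def)
  interpret Metric_space X d by fact
  obtain Q where Q: "countable Q" "Q \<subseteq> X" "S closure_of Q = X"
    using sep by (auto simp: separable_space_def S)
  define \<B> where "\<B> = (\<lambda>(q, n). mball q (inverse (Suc n))) ` (Q \<times> (UNIV :: nat set))"
  show ?thesis
    unfolding second_countable_def
  proof (intro exI[of _ \<B>] conjI ballI allI impI)
    show "countable \<B>" using Q(1) by (auto simp: \<B>_def)
    show "openin S V" if "V \<in> \<B>" for V
      using that by (auto simp: \<B>_def S)
    fix U x assume "openin S U \<and> x \<in> U"
    then obtain r where r: "r > 0" "mball x r \<subseteq> U" and x: "x \<in> X"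
      unfolding S openin_mtopology by blast
    obtain n where n: "inverse (Suc n) < r / 2"
      using reals_Archimedean[of "r/2"] r(1) by auto
    have "x \<in> S closure_of Q" using x Q(3) by simp
    then obtain q where q: "q \<in> Q" "q \<in> mball x (inverse (Suc n))"
      unfolding S metric_closure_of by (auto simp del: inverse_Suc of_nat_Suc)
        (meson inverse_positive_iff_positive of_nat_0_less_iff zero_less_Suc)
    have "mball q (inverse (Suc n)) \<subseteq> mball x r"
      using q n by (intro mball_subset) (auto simp: commute simp del: of_nat_Suc)
    moreover have "x \<in> mball q (inverse (Suc n))"
      using q x by (auto simp: commute)
    ultimately show "\<exists>V\<in>\<B>. x \<in> V \<and> V \<subseteq> U"
      using q(1) r(2) by (auto simp: \<B>_def intro!: exI[of _ q])
  qed
qed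

lemma (in standard_borel_prob_space) separable_measure_algebra:
  obtains D :: "nat \<Rightarrow> 'a set" where "range D \<subseteq> sets M"
    "\<And>A e. A \<in> sets M \<Longrightarrow> e > 0 \<Longrightarrow> \<exists>n. measure M (sym_diff A (D n)) < e"
proof -
  obtain S where S: "polish_topology S" "topspace S = space M" "sets M = sets (borel_of S)"
    using standard_borel by (auto simp: standard_borel_def)
  obtain \<B> where \<B>: "countable \<B>" "\<And>V. V \<in> \<B> \<Longrightarrow> openin S V"
      "\<And>U x. openin S U \<Longrightarrow> x \<in> U \<Longrightarrow> \<exists>V\<in>\<B>. x \<in> V \<and> V \<subseteq> U"
    using polish_topology_second_countable[OF S(1)] unfolding second_countable_def by metis
  define \<B>' where "\<B>' = insert {} \<B>"
  have "\<B>' \<noteq> {}" "countable \<B>'" using \<B>(1) by (auto simp: \<B>'_def)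
  then have E: "range (from_nat_into \<B>') = \<B>'"
    by (rule range_from_nat_into)
  have sets_M: "sets M = sigma_sets (space M) {U. openin S U}"
    unfolding S(3) borel_of_def using openin_subset[of S] S(2) by (subst sets_measure_of) auto
  have "sigma_sets (space M) {U. openin S U} = sigma_sets (space M) \<B>'"
  proof (rule sigma_sets_eqI)
    show "U \<in> sigma_sets (space M) \<B>'" if "U \<in> {U. openin S U}" for U
    proof -
      have "U = \<Union>{V\<in>\<B>. V \<subseteq> U}" using \<B>(3)[of U] that by (auto; metis)
      also have "\<dots> \<in> sigma_sets (space M) \<B>'"
        using \<B>(1) by (intro sigma_sets_UNION) (auto simp: \<B>'_def)
      finally show ?thesis .
    qed
    show "U \<in> sigma_sets (space M) {U. openin S U}" if "U \<in> \<B>'" for U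
      using that \<B>(2) by (auto simp: \<B>'_def)
  qed
  then have "sets M = sigma_sets (space M) (range (from_nat_into \<B>'))" by (simp add: sets_M E)
  from this that show thesis by (rule countably_generated_imp_separable)
qed

section \<open>Baire category\<close>

definition meagre_in :: "'a topology \<Rightarrow> 'a set \<Rightarrow> bool" where
  "meagre_in T A \<longleftrightarrow>
     (\<exists>\<C>. countable \<C> \<and> (\<forall>C\<in>\<C>. closedin T C \<and> T interior_of C = {}) \<and> A \<subseteq> \<Union>\<C>)"

lemma meagre_in_subset: "meagre_in T B \<Longrightarrow> A \<subseteq> B \<Longrightarrow> meagre_in T A"
  unfolding meagre_in_def by (meson subset_trans)

lemma meagre_in_empty: "meagre_in T {}"
  unfolding meagre_in_def by (intro exI[of _ "{}"]) auto

lemma meagre_in_UN: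
  assumes "countable I" "\<And>i. i \<in> I \<Longrightarrow> meagre_in T (A i)"
  shows "meagre_in T (\<Union>i\<in>I. A i)"
proof -
  obtain \<C> where \<C>: "\<And>i. i \<in> I \<Longrightarrow> countable (\<C> i)"
    "\<And>i C. i \<in> I \<Longrightarrow> C \<in> \<C> i \<Longrightarrow> closedin T C \<and> T interior_of C = {}"
    "\<And>i. i \<in> I \<Longrightarrow> A i \<subseteq> \<Union>(\<C> i)"
    using assms(2) unfolding meagre_in_def by metis
  show ?thesis
    unfolding meagre_in_def
  proof (intro exI[of _ "\<Union>i\<in>I. \<C> i"] conjI)
    show "countable (\<Union>i\<in>I. \<C> i)" using assms(1) \<C>(1) by (rule countable_UN)
    show "\<forall>C\<in>\<Union>i\<in>I. \<C> i. closedin T C \<and> T interior_of C = {}"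
      using \<C>(2) by (metis UN_E)
    show "(\<Union>i\<in>I. A i) \<subseteq> \<Union> (\<Union>i\<in>I. \<C> i)"
      using \<C>(3) by (simp add: UN_least UN_upper subset_iff) blast
  qed
qed

lemma meagre_in_Un: "meagre_in T A \<Longrightarrow> meagre_in T B \<Longrightarrow> meagre_in T (A \<union> B)"
  using meagre_in_UN[of "{True, False}" T "\<lambda>b. if b then A else B"] by (auto simp: Un_commute)

lemma meagre_in_homeomorphic_image:
  assumes f: "homeomorphic_map S T f" and A: "meagre_in S A"
  shows "meagre_in T (f ` A)"
proof -
  obtain \<C> where \<C>: "countable \<C>" "A \<subseteq> \<Union>\<C>"
    "\<And>C. C \<in> \<C> \<Longrightarrow> closedin S C" "\<And>C. C \<in> \<C> \<Longrightarrow> S interior_of C = {}"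
    using A by (auto simp: meagre_in_def)
  have "closedin T (f ` C) \<and> T interior_of (f ` C) = {}" if "C \<in> \<C>" for C
    using homeomorphic_map_closedness_eq[OF f] homeomorphic_map_interior_of[OF f] \<C>(3,4)[OF that]
      closedin_subset by (metis image_empty)
  then show ?thesis
    unfolding meagre_in_def using \<C>(1,2) by (intro exI[of _ "(`) f ` \<C>"]) (auto, blast)
qed

lemma openin_meagre_imp_empty:
  assumes "completely_metrizable_space T" "openin T U" "meagre_in T U"
  shows "U = {}"
proof -
  obtain \<C> where \<C>: "countable \<C>" "U \<subseteq> \<Union>\<C>"
    "\<And>C. C \<in> \<C> \<Longrightarrow> closedin T C \<and> T interior_of C = {}"
    using assms(3) by (auto simp: meagre_in_def)
  have "T interior_of \<Union>\<C> = {}"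
    using assms(1) \<C> by (intro Baire_category_alt) auto
  then show ?thesis
    using interior_of_maximal[OF \<C>(2) assms(2)] by auto
qed

text \<open>
  The sets that differ from an open set by a meagre set form a \<open>\<sigma>\<close>-algebra. For complements,
  the complement of an open set \<open>U\<close> differs from its interior only by the boundary of \<open>U\<close>,
  which is nowhere dense.
\<close>

lemma borel_of_has_Baire_property:
  assumes "A \<in> sets (borel_of T)"
  shows "\<exists>U. openin T U \<and> meagre_in T (sym_diff A U)"
proof -
  have "A \<in> sigma_sets (topspace T) {U. openin T U}"
    using assms openin_subset[of T] unfolding borel_of_def by (subst (asm) sets_measure_of) auto
  then show ?thesis
  proof induction
    case (Basic A)
    then show ?case using meagre_in_empty[of T] by (intro exI[of _ A]) auto
  next
    case Empty
    show ?case using meagre_in_empty[of T] by (intro exI[of _ "{}"]) auto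
  next
    case (Compl A)
    then obtain U where U: "openin T U" "meagre_in T (sym_diff A U)" by auto
    let ?V = "T interior_of (topspace T - U)"
    have cl: "closedin T (topspace T - U - ?V)"
      using U(1) by (intro closedin_diff) auto
    have "T interior_of (topspace T - U - ?V) = {}"
    proof -
      have "T interior_of (topspace T - U - ?V) \<subseteq> ?V"
        by (rule interior_of_mono) auto
      moreover have "T interior_of (topspace T - U - ?V) \<subseteq> topspace T - U - ?V"
        by (rule interior_of_subset)
      ultimately show ?thesis by blast
    qed
    with cl have "meagre_in T (topspace T - U - ?V)"
      unfolding meagre_in_def by (intro exI[of _ "{topspace T - U - ?V}"]) auto
    from meagre_in_Un[OF U(2) this]
    have "meagre_in T (sym_diff (topspace T - A) ?V)"
      by (rule meagre_in_subset) (use interior_of_subset[of T "topspace T - U"] in auto)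
    then show ?case
      by (intro exI[of _ ?V] conjI openin_interior_of)
  next
    case (Union A)
    then obtain U where U: "\<And>i::nat. openin T (U i)" "\<And>i. meagre_in T (sym_diff (A i) (U i))"
      by metis
    have "meagre_in T (\<Union>i. sym_diff (A i) (U i))"
      using U(2) by (intro meagre_in_UN) auto
    then have "meagre_in T (sym_diff (\<Union>i. A i) (\<Union>i. U i))"
      by (rule meagre_in_subset) auto
    moreover have "openin T (\<Union>i. U i)" using U(1) by auto
    ultimately show ?case
      by (intro exI[of _ "\<Union>i. U i"] conjI)
  qed
qed

section \<open>Continuity of the translation action on the measure algebra\<close>

context polish_group
begin

lemma homeomorphic_left_mult:
  assumes "g \<in> carrier G"
  shows "homeomorphic_map T T (\<lambda>x. g \<otimes> x)"
proof -
  have cont: "continuous_map T T (\<lambda>x. h \<otimes> x)" if "h \<in> carrier G" for h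
  proof -
    have "continuous_map T (prod_topology T T) (\<lambda>x. (h, x))"
      using that by (intro continuous_intros) (auto simp: topspace_eq)
    from continuous_map_compose[OF this continuous_mult] show ?thesis
      by (simp add: o_def)
  qed
  have "homeomorphic_maps T T (\<lambda>x. g \<otimes> x) (\<lambda>x. inv g \<otimes> x)"
    unfolding homeomorphic_maps_def using assms
    by (auto simp: cont topspace_eq m_assoc[symmetric])
  then show ?thesis by (rule homeomorphic_maps_map[THEN iffD1, THEN conjunct1])
qed

lemma continuous_right_mult:
  assumes "g \<in> carrier G"
  shows "continuous_map T T (\<lambda>x. x \<otimes> g)"
proof -
  have "continuous_map T (prod_topology T T) (\<lambda>x. (x, g))"
    using assms by (intro continuous_intros) (auto simp: topspace_eq)
  from continuous_map_compose[OF this continuous_mult] show ?thesis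
    by (simp add: o_def)
qed

lemma openin_right_mult_vimage:
  assumes "g \<in> carrier G" "openin T U"
  shows "openin T {x \<in> carrier G. x \<otimes> g \<in> U}"
  using openin_continuous_map_preimage[OF continuous_right_mult[OF assms(1)] assms(2)]
  by (simp add: topspace_eq)

lemma open_subgroup_within:
  assumes "non_archimedean G T" "openin T U" "\<one> \<in> U"
  obtains H where "subgroup H G" "openin T H" "H \<subseteq> U"
proof -
  obtain V H where "openin T V" "subgroup H G \<and> openin T H" "\<one> \<in> V" "V \<subseteq> H" "H \<subseteq> U"
    using assms unfolding non_archimedean_def neighbourhood_base_at_def by metis
  then show thesis by (auto intro: that)
qed

text \<open>
  A nonmeagre Borel set \<open>W\<close> is comeagre in some nonempty open set, hence in a right coset
  \<open>Hg\<close> of an open subgroup. For \<open>h \<in> H\<close> the translate \<open>hW\<close> is comeagre in \<open>hHg = Hg\<close> as well,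
  so \<open>W\<close> and \<open>hW\<close> meet.
\<close>

lemma Pettis_open_subgroup:
  assumes na: "non_archimedean G T" and W: "W \<in> sets (borel_of T)" "\<not> meagre_in T W"
  obtains H where "subgroup H G" "openin T H"
    "\<And>h. h \<in> H \<Longrightarrow> \<exists>v\<in>W. \<exists>w\<in>W. v = h \<otimes> w"
proof -
  have cm: "completely_metrizable_space T" using polish by (simp add: polish_topology_def)
  obtain U where U: "openin T U" and mU: "meagre_in T (sym_diff W U)"
    using borel_of_has_Baire_property[OF W(1)] by (elim exE conjE)
  have "U \<noteq> {}" using mU W(2) by auto
  then obtain g where g: "g \<in> U" by auto
  then have gG: "g \<in> carrier G" using openin_subset[OF U] topspace_eq by auto
  obtain H where H: "subgroup H G" "openin T H" "H \<subseteq> {x \<in> carrier G. x \<otimes> g \<in> U}"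
    using open_subgroup_within[OF na openin_right_mult_vimage[OF gG U]] g gG by auto
  let ?Hg = "{x \<in> carrier G. x \<otimes> inv g \<in> H}"
  have Hg_open: "openin T ?Hg" using gG H(2) by (intro openin_right_mult_vimage) auto
  have Hg_sub: "?Hg \<subseteq> U"
  proof
    fix x assume "x \<in> ?Hg"
    with H(3) have x: "x \<in> carrier G" "(x \<otimes> inv g) \<otimes> g \<in> U" by auto
    then show "x \<in> U" using gG by (simp add: m_assoc)
  qed
  have gHg: "g \<in> ?Hg" using gG H(1) by (simp add: subgroup.one_closed)
  have "meagre_in T (U - W)" using mU by (rule meagre_in_subset) auto
  then have small: "meagre_in T (?Hg - W)" by (rule meagre_in_subset) (use Hg_sub in auto)
  show thesis
  proof (rule that[OF H(1,2)])
    fix h assume h: "h \<in> H"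
    with H(1) have hG: "h \<in> carrier G" by (rule subgroup.mem_carrier)
    let ?B = "(\<lambda>x. h \<otimes> x) ` (?Hg - W)"
    have "meagre_in T ?B"
      using homeomorphic_left_mult[OF hG] small by (rule meagre_in_homeomorphic_image)
    then have m: "meagre_in T ((?Hg - W) \<union> ?B)" by (rule meagre_in_Un[OF small])
    have "\<not> ?Hg \<subseteq> (?Hg - W) \<union> ?B"
    proof
      assume "?Hg \<subseteq> (?Hg - W) \<union> ?B"
      then have "meagre_in T ?Hg" by (rule meagre_in_subset[OF m])
      then have "?Hg = {}" by (rule openin_meagre_imp_empty[OF cm Hg_open])
      then show False using gHg by blast
    qed
    then obtain v where v: "v \<in> ?Hg" "v \<in> W" "v \<notin> ?B" by blast
    define w where "w = inv h \<otimes> v"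
    have wG: "w \<in> carrier G" using hG v(1) by (simp add: w_def)
    have vw: "v = h \<otimes> w" using hG v(1) by (simp add: w_def m_assoc[symmetric])
    have "inv h \<otimes> (v \<otimes> inv g) \<in> H"
      using h v(1) H(1) by (auto intro: subgroup.m_closed subgroup.m_inv_closed)
    then have "w \<in> ?Hg" using wG hG gG v(1) by (simp add: w_def m_assoc)
    then have "w \<in> W" using v(3) vw by blast
    then show "\<exists>v\<in>W. \<exists>w\<in>W. v = h \<otimes> w" using v(2) vw by blast
  qed
qed

end

context near_action
begin

text \<open>
  Preimages are always measurable, unlike images under a near-action; they turn the left
  action into a right action on sets, which accounts for the order of the factors in
  \<open>AE_pull_mult\<close>.
\<close>

abbreviation pull :: "'g \<Rightarrow> 'a set \<Rightarrow> 'a set" where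
  "pull g A \<equiv> act g -` A \<inter> space M"

lemma measurable_act: "g \<in> carrier G \<Longrightarrow> act g \<in> M \<rightarrow>\<^sub>M M"
  using measurable_section[OF borel_act] by (simp add: topspace_eq)

lemma pull_sets: "g \<in> carrier G \<Longrightarrow> A \<in> sets M \<Longrightarrow> pull g A \<in> sets M"
  by (rule measurable_sets[OF measurable_act])

lemma act_in_space: "g \<in> carrier G \<Longrightarrow> x \<in> space M \<Longrightarrow> act g x \<in> space M"
  by (rule measurable_space[OF measurable_act])

lemma AE_act:
  assumes "g \<in> carrier G" "AE x in M. P x"
  shows "AE x in M. P (act g x)"
  using assms(2) AE_distrD[OF measurable_act[OF assms(1)], of P] by (simp only: act_preserves[OF assms(1)])

lemma measure_pull:
  assumes "g \<in> carrier G" "A \<in> sets M"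
  shows "measure M (pull g A) = measure M A"
  using measure_distr[OF measurable_act assms(2), of g] assms(1) act_preserves by simp

lemma measure_pull_sym_diff:
  assumes "g \<in> carrier G" "A \<in> sets M" "B \<in> sets M"
  shows "measure M (sym_diff (pull g A) (pull g B)) = measure M (sym_diff A B)"
proof -
  have "sym_diff (pull g A) (pull g B) = pull g (sym_diff A B)" by auto
  then show ?thesis using measure_pull[OF assms(1), of "sym_diff A B"] assms(2,3) by simp
qed

lemma AE_pull_mult:
  assumes "g \<in> carrier G" "h \<in> carrier G"
  shows "AE x in M. x \<in> pull (g \<otimes> h) A \<longleftrightarrow> x \<in> pull h (pull g A)"
  using AE_act_mult[OF assms] AE_space
  by eventually_elim (auto simp: act_in_space[OF assms(2)])

text \<open>
  The function is a section measure of a measurable subset of the product of the group and the space.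
\<close>

lemma measurable_displacement:
  assumes [measurable]: "A \<in> sets M" "B \<in> sets M"
  shows "(\<lambda>g. measure M (sym_diff (pull g A) B)) \<in> borel_measurable (borel_of T)"
proof -
  have space_T: "space (borel_of T) = carrier G"
    by (simp add: borel_of_def space_measure_of_conv topspace_eq)
  note [measurable] = borel_act
  define Q where "Q = {p \<in> space (borel_of T \<Otimes>\<^sub>M M).
      ((\<lambda>(g, x). act g x) p \<in> A) \<noteq> (snd p \<in> B)}"
  have Q: "Q \<in> sets (borel_of T \<Otimes>\<^sub>M M)"
    unfolding Q_def by measurable
  have "Pair g -` Q = sym_diff (pull g A) B" if "g \<in> carrier G" for g
    using that sets.sets_into_space[OF assms(2)]
    by (auto simp: Q_def space_pair_measure space_T)
  then have "measure M (sym_diff (pull g A) B) = enn2real (emeasure M (Pair g -` Q))"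
    if "g \<in> space (borel_of T)" for g
    using that by (simp add: measure_def space_T)
  moreover have "(\<lambda>g. enn2real (emeasure M (Pair g -` Q))) \<in> borel_measurable (borel_of T)"
    using measurable_emeasure_Pair[OF Q] by measurable
  ultimately show ?thesis by (simp cong: measurable_cong)
qed

text \<open>
  This is the automatic continuity of the Borel homomorphism into the automorphism group.
  The measure algebra is separable, so countably many Borel sets of the form
  \<open>{g. A\<^bsub>g\<^esub> is within e/2 of D n}\<close> cover \<open>G\<close>, and by the Baire category theorem one of them,
  \<open>W\<close>, is not meagre. If \<open>v = hw\<close> with \<open>v, w \<in> W\<close>, then \<open>w\<close> moves the pair \<open>A\<^bsub>h\<^esub>, A\<close> to the pair
  \<open>A\<^bsub>v\<^esub>, A\<^bsub>w\<^esub>\<close>, both within \<open>e/2\<close> of the same set.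
\<close>

lemma open_subgroup_small_displacement:
  assumes na: "non_archimedean G T" and A: "A \<in> sets M" and "e > 0"
  obtains H where "subgroup H G" "openin T H"
    "\<And>h. h \<in> H \<Longrightarrow> measure M (sym_diff (pull h A) A) < e"
proof -
  obtain D :: "nat \<Rightarrow> 'a set" where D: "range D \<subseteq> sets M"
    and dense: "\<And>A e. A \<in> sets M \<Longrightarrow> e > 0 \<Longrightarrow> \<exists>n. measure M (sym_diff A (D n)) < e"
    using separable_measure_algebra by blast
  have Dn: "D n \<in> sets M" for n using D by auto
  define W where "W n = {g \<in> carrier G. measure M (sym_diff (pull g A) (D n)) < e / 2}" for n
  have space_T: "space (borel_of T) = carrier G"
    by (simp add: borel_of_def space_measure_of_conv topspace_eq)
  have W: "W n \<in> sets (borel_of T)" for n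
    using borel_measurable_less[OF measurable_displacement[OF A Dn] borel_measurable_const, of n "e/2"]
    unfolding W_def space_T .
  have cover: "carrier G \<subseteq> (\<Union>n. W n)"
    using dense[OF pull_sets[OF _ A], of _ "e/2"] \<open>e > 0\<close> by (auto simp: W_def)
  have "\<exists>n. \<not> meagre_in T (W n)"
  proof (rule ccontr)
    assume "\<not> ?thesis"
    then have "meagre_in T (\<Union>n. W n)" by (intro meagre_in_UN) auto
    then have "meagre_in T (topspace T)" using cover
      unfolding topspace_eq by (rule meagre_in_subset)
    then have "topspace T = {}"
      using polish by (intro openin_meagre_imp_empty) (auto simp: polish_topology_def)
    then show False using topspace_eq by auto
  qed
  then obtain n where n: "\<not> meagre_in T (W n)" by auto
  obtain H where H: "subgroup H G" "openin T H"
    and quot: "\<And>h. h \<in> H \<Longrightarrow> \<exists>v\<in>W n. \<exists>w\<in>W n. v = h \<otimes> w"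
    using Pettis_open_subgroup[OF na W n] by blast
  show thesis
  proof (rule that[OF H])
    fix h assume h: "h \<in> H"
    with H(1) have hG: "h \<in> carrier G" by (rule subgroup.mem_carrier)
    obtain v w where vw: "v \<in> W n" "w \<in> W n" "v = h \<otimes> w" using quot[OF h] by auto
    then have wG: "w \<in> carrier G" and vG: "v \<in> carrier G" by (auto simp: W_def)
    note sets = pull_sets[OF hG A] pull_sets[OF wG A] pull_sets[OF vG A] pull_sets[OF wG pull_sets[OF hG A]]
    have "measure M (sym_diff (pull h A) A) = measure M (sym_diff (pull w (pull h A)) (pull w A))"
      using measure_pull_sym_diff[OF wG sets(1) A] by simp
    also have "\<dots> = measure M (sym_diff (pull v A) (pull w A))"
      using measure_sym_diff_cong[OF AE_pull_mult[OF hG wG], of A] sets vw(3) by simp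
    also have "\<dots> \<le> measure M (sym_diff (pull v A) (D n)) + measure M (sym_diff (D n) (pull w A))"
      using sets Dn by (intro measure_sym_diff_triangle)
    also have "\<dots> < e"
      using vw(1,2) by (simp add: W_def Un_commute)
    finally show "measure M (sym_diff (pull h A) A) < e" .
  qed
qed

end

section \<open>Invariant sets for a subgroup\<close>

lemma (in prob_space) bounded_imp_integrable:
  fixes f :: "'a \<Rightarrow> real"
  assumes "f \<in> borel_measurable M" "AE x in M. \<bar>f x\<bar> \<le> B"
  shows "integrable M f"
  using assms by (intro integrable_const_bound[where B=B]) auto

text \<open>
  The total variation of the sequence at a point has a finite integral, so it is finite
  almost everywhere.
\<close>

lemma (in prob_space) summable_L1_imp_AE_convergent:
  fixes u :: "nat \<Rightarrow> 'a \<Rightarrow> real"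
  assumes [measurable]: "\<And>n. integrable M (u n)"
    and bound: "\<And>n. (\<integral>x. \<bar>u (Suc n) x - u n x\<bar> \<partial>M) \<le> c n" and "summable c"
  shows "AE x in M. convergent (\<lambda>n. u n x)"
proof -
  have [measurable]: "u n \<in> borel_measurable M" for n
    using assms(1) by (rule borel_measurable_integrable)
  have c_nonneg: "0 \<le> c n" for n
    using bound[of n] by (rule order_trans[rotated]) simp
  have "(\<integral>\<^sup>+x. (\<Sum>n. ennreal \<bar>u (Suc n) x - u n x\<bar>) \<partial>M) = (\<Sum>n. \<integral>\<^sup>+x. ennreal \<bar>u (Suc n) x - u n x\<bar> \<partial>M)"
    by (intro nn_integral_suminf) measurable
  also have "\<dots> = (\<Sum>n. ennreal (\<integral>x. \<bar>u (Suc n) x - u n x\<bar> \<partial>M))"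
    using assms(1) by (intro suminf_cong nn_integral_eq_integral) auto
  also have "\<dots> \<le> (\<Sum>n. ennreal (c n))"
    using bound by (intro suminf_le ennreal_leI) auto
  also have "\<dots> < \<infinity>"
    using ennreal_suminf_neq_top[OF \<open>summable c\<close> c_nonneg] by (simp add: less_top[symmetric])
  finally have "AE x in M. (\<Sum>n. ennreal \<bar>u (Suc n) x - u n x\<bar>) \<noteq> \<infinity>"
    by (intro nn_integral_PInf_AE) auto
  then show ?thesis
  proof eventually_elim
    case (elim x)
    then have "summable (\<lambda>n. \<bar>u (Suc n) x - u n x\<bar>)"
      by (intro summable_suminf_not_top) auto
    then have "summable (\<lambda>n. u (Suc n) x - u n x)"
      by (rule summable_rabs_cancel)
    then have "(\<lambda>N. \<Sum>n<N. u (Suc n) x - u n x) \<longlonglongrightarrow> (\<Sum>n. u (Suc n) x - u n x)"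
      by (rule summable_LIMSEQ)
    then have "(\<lambda>N. u N x - u 0 x) \<longlonglongrightarrow> (\<Sum>n. u (Suc n) x - u n x)"
      using sum_lessThan_telescope[of "\<lambda>n. u n x"] by simp
    from tendsto_add[OF this tendsto_const[of "u 0 x"]]
    show ?case by (auto simp: convergent_def)
  qed
qed

text \<open>
  A closed convex set of functions has a unique element of least \<open>L\<^sup>2\<close> norm. By the
  parallelogram law two elements of almost minimal norm are close, since their midpoint has
  at least the minimal norm; this gives both convergence of a minimising sequence and
  uniqueness. The infimum is approached at the rate \<open>4\<^sup>-\<^sup>n\<close> so that the sequence itself,
  not only a subsequence, converges almost everywhere. This form of closedness, under limits
  almost everywhere, suffices because of the uniform bound.
\<close>

lemma (in prob_space) least_L2_norm_attained:
  fixes C :: "('a \<Rightarrow> real) set"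
  assumes ne: "C \<noteq> {}"
    and meas: "\<And>f. f \<in> C \<Longrightarrow> f \<in> borel_measurable M"
    and bounded: "\<And>f. f \<in> C \<Longrightarrow> AE x in M. \<bar>f x\<bar> \<le> 1"
    and midpoint: "\<And>f g. f \<in> C \<Longrightarrow> g \<in> C \<Longrightarrow> (\<lambda>x. (f x + g x) / 2) \<in> C"
    and closed: "\<And>u f. (\<And>n. u n \<in> C) \<Longrightarrow> f \<in> borel_measurable M \<Longrightarrow>
                   (AE x in M. (\<lambda>n. u n x) \<longlonglongrightarrow> f x) \<Longrightarrow> f \<in> C"
  shows "\<exists>f\<in>C. \<forall>g\<in>C. (\<integral>x. (g x)\<^sup>2 \<partial>M) = (\<integral>x. (f x)\<^sup>2 \<partial>M) \<longrightarrow> (AE x in M. f x = g x)"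
proof -
  define I where "I = (INF f\<in>C. \<integral>x. (f x)\<^sup>2 \<partial>M)"
  have bdd: "bdd_below ((\<lambda>f. \<integral>x. (f x)\<^sup>2 \<partial>M) ` C)"
    by (rule bdd_belowI2[of _ 0]) simp
  have I_le: "I \<le> (\<integral>x. (f x)\<^sup>2 \<partial>M)" if "f \<in> C" for f
    unfolding I_def using bdd that by (rule cINF_lower)
  have int2: "integrable M (\<lambda>x. (f x)\<^sup>2)" if "f \<in> C" for f
  proof (rule bounded_imp_integrable)
    show "(\<lambda>x. (f x)\<^sup>2) \<in> borel_measurable M" using meas[OF that] by measurable
    show "AE x in M. \<bar>(f x)\<^sup>2\<bar> \<le> 1"
      using bounded[OF that] by eventually_elim (simp add: abs_square_le_1)
  qed
  have diff2_measurable: "(\<lambda>x. (f x - g x)\<^sup>2) \<in> borel_measurable M" if "f \<in> C" "g \<in> C" for f g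
    using meas[OF that(1)] meas[OF that(2)] by measurable
  have diff2: "integrable M (\<lambda>x. (f x - g x)\<^sup>2)"
    "(\<integral>x. (f x - g x)\<^sup>2 \<partial>M) \<le> 2 * (\<integral>x. (f x)\<^sup>2 \<partial>M) + 2 * (\<integral>x. (g x)\<^sup>2 \<partial>M) - 4 * I"
    if f: "f \<in> C" and g: "g \<in> C" for f g
  proof -
    let ?m = "\<lambda>x. (f x + g x) / 2"
    have m: "?m \<in> C" using f g by (rule midpoint)
    have eq: "(f x - g x)\<^sup>2 = 2 * (f x)\<^sup>2 + 2 * (g x)\<^sup>2 - 4 * (?m x)\<^sup>2" for x
      by (simp add: power2_eq_square field_simps)
    show "integrable M (\<lambda>x. (f x - g x)\<^sup>2)"
      unfolding eq using int2[OF f] int2[OF g] int2[OF m] by simp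
    have "(\<integral>x. (f x - g x)\<^sup>2 \<partial>M) =
        2 * (\<integral>x. (f x)\<^sup>2 \<partial>M) + 2 * (\<integral>x. (g x)\<^sup>2 \<partial>M) - 4 * (\<integral>x. (?m x)\<^sup>2 \<partial>M)"
      unfolding eq using int2[OF f] int2[OF g] int2[OF m]
      by (subst Bochner_Integration.integral_diff Bochner_Integration.integral_add;
          simp only: Bochner_Integration.integrable_add integrable_mult_right integral_mult_right_zero)+
    then show "(\<integral>x. (f x - g x)\<^sup>2 \<partial>M) \<le> 2 * (\<integral>x. (f x)\<^sup>2 \<partial>M) + 2 * (\<integral>x. (g x)\<^sup>2 \<partial>M) - 4 * I"
      using I_le[OF m] by simp
  qed
  have "\<exists>f\<in>C. (\<integral>x. (f x)\<^sup>2 \<partial>M) < I + (1/4)^n" for n :: nat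
    using cINF_less_iff[OF ne bdd, of "I + (1/4)^n"] by (simp add: I_def)
  then obtain u where u: "\<And>n. u n \<in> C" and u_le: "\<And>n. (\<integral>x. (u n x)\<^sup>2 \<partial>M) < I + (1/4)^n"
    by metis
  have [measurable]: "u n \<in> borel_measurable M" for n using u by (rule meas)
  have int: "integrable M (u n)" for n
    using meas[OF u] bounded[OF u] by (rule bounded_imp_integrable)
  have "AE x in M. convergent (\<lambda>n. u n x)"
  proof (rule summable_L1_imp_AE_convergent[OF int])
    show "summable (\<lambda>n. 5 * (1/2::real)^n)"
      by (intro summable_mult summable_geometric) simp
    fix n
    note d = diff2[OF u u, of "Suc n" n]
    \<comment> \<open>in place of the Cauchy--Schwarz inequality: \<open>t \<le> a + t\<^sup>2 / a\<close> with \<open>a = 2\<^sup>-\<^sup>n\<close>\<close>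
    have pointwise: "\<bar>u (Suc n) x - u n x\<bar> \<le> (1/2)^n + 2^n * (u (Suc n) x - u n x)\<^sup>2" for x
    proof -
      let ?t = "\<bar>u (Suc n) x - u n x\<bar>"
      have "0 \<le> 2^n * (?t - (1/2)^n)\<^sup>2 + ?t"
        by simp
      also have "\<dots> = 2^n * ?t\<^sup>2 + (1/2)^n - ?t"
        by (simp add: power2_eq_square field_simps)
      finally show ?thesis by simp
    qed
    have "(\<integral>x. \<bar>u (Suc n) x - u n x\<bar> \<partial>M) \<le> (\<integral>x. (1/2)^n + 2^n * (u (Suc n) x - u n x)\<^sup>2 \<partial>M)"
      using pointwise int d(1) by (intro integral_mono) auto
    also have "\<dots> = (1/2)^n + 2^n * (\<integral>x. (u (Suc n) x - u n x)\<^sup>2 \<partial>M)"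
      using d(1) by (simp add: prob_space)
    also have "\<dots> \<le> (1/2)^n + 2^n * (4 * (1/4)^n)"
    proof -
      have "(1/4::real)^Suc n \<le> (1/4)^n" by simp
      then have "(\<integral>x. (u (Suc n) x - u n x)\<^sup>2 \<partial>M) \<le> 4 * (1/4)^n"
        using d(2) u_le[of n] u_le[of "Suc n"] by linarith
      then show ?thesis by simp
    qed
    also have "\<dots> = 5 * (1/2)^n"
      by (simp add: power_divide field_simps flip: power_mult_distrib)
    finally show "(\<integral>x. \<bar>u (Suc n) x - u n x\<bar> \<partial>M) \<le> 5 * (1/2)^n" .
  qed
  then have lim: "AE x in M. (\<lambda>n. u n x) \<longlonglongrightarrow> lim (\<lambda>n. u n x)"
    by eventually_elim (simp add: convergent_LIMSEQ_iff)
  define f where "f x = lim (\<lambda>n. u n x)" for x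
  have [measurable]: "f \<in> borel_measurable M" unfolding f_def by measurable
  have f: "f \<in> C"
    using u by (rule closed) (use lim in \<open>simp_all add: f_def\<close>)
  have "(\<lambda>n. \<integral>x. (u n x)\<^sup>2 \<partial>M) \<longlonglongrightarrow> (\<integral>x. (f x)\<^sup>2 \<partial>M)"
  proof (rule integral_dominated_convergence[where w="\<lambda>_. 1"])
    show "AE x in M. (\<lambda>n. (u n x)\<^sup>2) \<longlonglongrightarrow> (f x)\<^sup>2"
      using lim by eventually_elim (auto simp: f_def intro: tendsto_power)
    show "AE x in M. norm ((u n x)\<^sup>2) \<le> 1" for n
      using bounded[OF u] by eventually_elim (simp add: abs_square_le_1)
  qed auto
  moreover have "(\<lambda>n. I + (1/4)^n) \<longlonglongrightarrow> I + 0"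
    by (intro tendsto_intros LIMSEQ_power_zero) auto
  ultimately have "(\<integral>x. (f x)\<^sup>2 \<partial>M) \<le> I + 0"
    using u_le by (intro LIMSEQ_le[of _ _ "\<lambda>n. I + (1/4)^n"]) (auto intro: less_imp_le)
  then have f_eq: "(\<integral>x. (f x)\<^sup>2 \<partial>M) = I" using I_le[OF f] by simp
  show ?thesis
  proof (intro bexI[OF _ f] ballI impI)
    fix g assume g: "g \<in> C" "(\<integral>x. (g x)\<^sup>2 \<partial>M) = (\<integral>x. (f x)\<^sup>2 \<partial>M)"
    have "(\<integral>x. (f x - g x)\<^sup>2 \<partial>M) = 0"
      using diff2(2)[OF f g(1)] g(2) f_eq by (intro antisym) auto
    then have "AE x in M. (f x - g x)\<^sup>2 = 0"
      using integral_nonneg_eq_0_iff_AE[OF diff2(1)[OF f g(1)]] by simp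
    then show "AE x in M. f x = g x" by eventually_elim simp
  qed
qed

context near_action
begin

text \<open>
  Let \<open>C\<close> consist of the functions with values between 0 and 1 all of whose translates by
  \<open>H\<close> stay within \<open>e\<close> of the indicator of \<open>A\<close> in \<open>L\<^sup>1\<close>. This set is convex, closed and
  invariant under \<open>H\<close>, and by the assumption on displacements it contains the indicator of \<open>A\<close>.
  Translation by \<open>H\<close> preserves the \<open>L\<^sup>2\<close> norm, so the element of least norm is invariant.
  It is cut at height \<open>1/2\<close>; where the resulting set disagrees with \<open>A\<close>, the function is
  at distance at least \<open>1/2\<close> from the indicator, hence the factor 2.
\<close>

lemma invariant_approximation:
  assumes H: "subgroup H G" and A [measurable]: "A \<in> sets M"
    and disp: "\<And>h. h \<in> H \<Longrightarrow> measure M (sym_diff (pull h A) A) \<le> e"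
  obtains S where "S \<in> sets M" "measure M (sym_diff A S) \<le> 2 * e"
    "\<And>h. h \<in> H \<Longrightarrow> AE x in M. x \<in> pull h S \<longleftrightarrow> x \<in> S"
proof -
  have HG: "h \<in> carrier G" if "h \<in> H" for h
    using H that by (rule subgroup.mem_carrier)
  have act_meas [measurable]: "act h \<in> M \<rightarrow>\<^sub>M M" if "h \<in> H" for h
    using HG[OF that] by (rule measurable_act)
  define dev where "dev f h = (\<integral>x. \<bar>f (act h x) - indicat_real A x\<bar> \<partial>M)" for f h
  define C where "C = {f \<in> borel_measurable M. (AE x in M. 0 \<le> f x \<and> f x \<le> 1) \<and> (\<forall>h\<in>H. dev f h \<le> e)}"
  have C_meas: "f \<in> borel_measurable M" and C_range: "AE x in M. 0 \<le> f x \<and> f x \<le> 1"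
    and C_dev: "h \<in> H \<Longrightarrow> dev f h \<le> e" if "f \<in> C" for f h
    using that by (auto simp: C_def)
  have dev_range: "AE x in M. \<bar>f (act h x) - indicat_real A x\<bar> \<le> 1" if "f \<in> C" "h \<in> H" for f h
    using AE_act[OF HG[OF that(2)] C_range[OF that(1)]]
    by eventually_elim (auto simp: indicator_def)
  have dev_meas: "(\<lambda>x. \<bar>f (act h x) - indicat_real A x\<bar>) \<in> borel_measurable M" if "f \<in> C" "h \<in> H" for f h
  proof -
    note [measurable] = C_meas[OF that(1)] act_meas[OF that(2)]
    show ?thesis by measurable
  qed
  have dev_int: "integrable M (\<lambda>x. \<bar>f (act h x) - indicat_real A x\<bar>)" if "f \<in> C" "h \<in> H" for f h
    by (rule bounded_imp_integrable[OF dev_meas[OF that]]) (use dev_range[OF that] in simp)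
  have "indicat_real A \<in> C"
  proof -
    have "dev (indicat_real A) h \<le> e" if h: "h \<in> H" for h
    proof -
      have "dev (indicat_real A) h = (\<integral>x. indicator (sym_diff (pull h A) A) x \<partial>M)"
        unfolding dev_def
        by (intro Bochner_Integration.integral_cong) (auto simp: indicator_def)
      also have "\<dots> = measure M (sym_diff (pull h A) A)"
        using pull_sets[OF HG[OF h] A] by simp
      finally show ?thesis using disp[OF h] by simp
    qed
    then show ?thesis by (auto simp: C_def indicator_def)
  qed
  then have ne: "C \<noteq> {}" by blast
  have mid: "(\<lambda>x. (f x + g x) / 2) \<in> C" if f: "f \<in> C" and g: "g \<in> C" for f g
  proof -
    have "AE x in M. 0 \<le> (f x + g x) / 2 \<and> (f x + g x) / 2 \<le> 1"
      using C_range[OF f] C_range[OF g] by eventually_elim auto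
    moreover have "dev (\<lambda>x. (f x + g x) / 2) h \<le> e" if h: "h \<in> H" for h
    proof -
      have "dev (\<lambda>x. (f x + g x) / 2) h \<le> (\<integral>x. (\<bar>f (act h x) - indicat_real A x\<bar> +
              \<bar>g (act h x) - indicat_real A x\<bar>) / 2 \<partial>M)"
        unfolding dev_def
      proof (rule integral_mono')
        show "integrable M (\<lambda>x. (\<bar>f (act h x) - indicat_real A x\<bar> + \<bar>g (act h x) - indicat_real A x\<bar>) / 2)"
          using dev_int[OF f h] dev_int[OF g h] by simp
      qed (auto simp: field_simps abs_if)
      also have "\<dots> = (dev f h + dev g h) / 2"
        unfolding dev_def using dev_int[OF f h] dev_int[OF g h] by simp
      also have "\<dots> \<le> e" using C_dev[OF f h] C_dev[OF g h] by simp
      finally show ?thesis .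
    qed
    ultimately show ?thesis using C_meas[OF f] C_meas[OF g] by (simp add: C_def)
  qed
  have closed: "f \<in> C" if u: "\<And>n. u n \<in> C" and f [measurable]: "f \<in> borel_measurable M"
    and lim: "AE x in M. (\<lambda>n. u n x) \<longlonglongrightarrow> f x" for u f
  proof -
    have "AE x in M. \<forall>n. 0 \<le> u n x \<and> u n x \<le> 1"
      using C_range[OF u] by (simp add: AE_all_countable)
    then have "AE x in M. 0 \<le> f x \<and> f x \<le> 1"
      using lim by eventually_elim (auto intro: LIMSEQ_le_const LIMSEQ_le_const2)
    moreover have "dev f h \<le> e" if h: "h \<in> H" for h
    proof -
      have "(\<lambda>n. dev (u n) h) \<longlonglongrightarrow> dev f h"
        unfolding dev_def
      proof (rule integral_dominated_convergence[where w="\<lambda>_. 1"])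
        show "AE x in M. (\<lambda>n. \<bar>u n (act h x) - indicat_real A x\<bar>) \<longlonglongrightarrow> \<bar>f (act h x) - indicat_real A x\<bar>"
          using AE_act[OF HG[OF h] lim] by eventually_elim (auto intro!: tendsto_intros)
        show "AE x in M. norm \<bar>u n (act h x) - indicat_real A x\<bar> \<le> 1" for n
          using dev_range[OF u h] by simp
        show "(\<lambda>x. \<bar>f (act h x) - indicat_real A x\<bar>) \<in> borel_measurable M"
          using act_meas[OF h] by measurable
      qed (use dev_meas[OF u h] in auto)
      then show ?thesis using C_dev[OF u h] by (intro LIMSEQ_le_const2) auto
    qed
    ultimately show ?thesis by (simp add: C_def)
  qed
  have shift: "(\<lambda>x. f (act h x)) \<in> C" if f: "f \<in> C" and h: "h \<in> H" for f h
  proof -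
    note [measurable] = C_meas[OF f]
    have "dev (\<lambda>x. f (act h x)) k \<le> e" if k: "k \<in> H" for k
    proof -
      have hk: "h \<otimes> k \<in> H" using H h k by (rule subgroup.m_closed)
      have "dev (\<lambda>x. f (act h x)) k = dev f (h \<otimes> k)"
        unfolding dev_def
      proof (rule integral_cong_AE)
        show "AE x in M. \<bar>f (act h (act k x)) - indicat_real A x\<bar> = \<bar>f (act (h \<otimes> k) x) - indicat_real A x\<bar>"
          using AE_act_mult[OF HG[OF h] HG[OF k]] by eventually_elim simp
        show "(\<lambda>x. \<bar>f (act h (act k x)) - indicat_real A x\<bar>) \<in> borel_measurable M"
          using act_meas[OF h] act_meas[OF k] by measurable
      qed (rule dev_meas[OF f hk])
      then show ?thesis using C_dev[OF f hk] by simp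
    qed
    moreover have "(\<lambda>x. f (act h x)) \<in> borel_measurable M"
      using act_meas[OF h] by measurable
    ultimately show ?thesis
      using AE_act[OF HG[OF h] C_range[OF f]] by (simp add: C_def)
  qed
  have C_abs: "AE x in M. \<bar>f x\<bar> \<le> 1" if "f \<in> C" for f
    using C_range[OF that] by eventually_elim auto
  have "\<exists>f\<in>C. \<forall>g\<in>C. (\<integral>x. (g x)\<^sup>2 \<partial>M) = (\<integral>x. (f x)\<^sup>2 \<partial>M) \<longrightarrow> (AE x in M. f x = g x)"
    by (rule least_L2_norm_attained[OF ne]) (fact C_meas C_abs mid closed)+
  then obtain f where f: "f \<in> C"
    and unique: "\<And>g. g \<in> C \<Longrightarrow> (\<integral>x. (g x)\<^sup>2 \<partial>M) = (\<integral>x. (f x)\<^sup>2 \<partial>M) \<Longrightarrow> AE x in M. f x = g x"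
    by auto
  note f_meas [measurable] = C_meas[OF f]
  have inv: "AE x in M. f x = f (act h x)" if h: "h \<in> H" for h
  proof (rule unique[OF shift[OF f h]])
    have "(\<integral>x. (f (act h x))\<^sup>2 \<partial>M) = (\<integral>x. (f x)\<^sup>2 \<partial>distr M M (act h))"
      using act_meas[OF h] by (subst integral_distr) auto
    then show "(\<integral>x. (f (act h x))\<^sup>2 \<partial>M) = (\<integral>x. (f x)\<^sup>2 \<partial>M)"
      using act_preserves[OF HG[OF h]] by simp
  qed
  define S where "S = {x \<in> space M. f x > 1/2}"
  have S [measurable]: "S \<in> sets M" unfolding S_def by measurable
  have one: "\<one> \<in> H" using H by (rule subgroup.one_closed)
  \<comment> \<open>the bound defining \<open>C\<close> is used for \<open>h = \<one>\<close>, whose action is the identity only almost everywhere\<close>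
  have "measure M (sym_diff A S) = (\<integral>x. indicat_real (sym_diff A S) x \<partial>M)"
    by simp
  also have "\<dots> \<le> (\<integral>x. 2 * \<bar>f (act \<one> x) - indicat_real A x\<bar> \<partial>M)"
  proof (rule integral_mono_AE)
    show "AE x in M. indicat_real (sym_diff A S) x \<le> 2 * \<bar>f (act \<one> x) - indicat_real A x\<bar>"
      using inv[OF one] AE_space by eventually_elim (auto simp: S_def indicator_def)
    show "integrable M (\<lambda>x. 2 * \<bar>f (act \<one> x) - indicat_real A x\<bar>)"
      using dev_int[OF f one] by simp
    show "integrable M (indicat_real (sym_diff A S))"
    proof (rule integrable_real_indicator)
      show "sym_diff A S \<in> sets M" by measurable
    qed (simp add: emeasure_eq_measure)
  qed
  also have "\<dots> = 2 * dev f \<one>" by (simp add: dev_def)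
  also have "\<dots> \<le> 2 * e" using C_dev[OF f one] by simp
  finally have close: "measure M (sym_diff A S) \<le> 2 * e" .
  show thesis
  proof (rule that[OF S close])
    fix h assume h: "h \<in> H"
    show "AE x in M. x \<in> pull h S \<longleftrightarrow> x \<in> S"
      using inv[OF h] AE_space
      by eventually_elim (auto simp: S_def act_in_space[OF HG[OF h]])
  qed
qed

end

section \<open>Smooth classes\<close>

context near_action
begin

abbreviation cls :: "'a set \<Rightarrow> 'a set set" where
  "cls A \<equiv> null_rel M `` {A}"

abbreviation translate :: "'g \<Rightarrow> 'a set set \<Rightarrow> 'a set set" where
  "translate \<equiv> malg_act G M act"

lemma cls_in_malg: "A \<in> sets M \<Longrightarrow> cls A \<in> malg M"
  unfolding malg_def by (rule quotientI)

lemma malg_cases: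
  assumes "a \<in> malg M"
  obtains A where "A \<in> sets M" "a = cls A"
  using assms unfolding malg_def by (rule quotientE)

lemma cls_eq_iff:
  assumes "A \<in> sets M" "B \<in> sets M"
  shows "cls A = cls B \<longleftrightarrow> (AE x in M. x \<in> A \<longleftrightarrow> x \<in> B)"
  using eq_equiv_class_iff[OF equiv_null_rel assms] assms by (simp add: null_rel_iff_AE)

lemma cls_self: "A \<in> sets M \<Longrightarrow> A \<in> cls A"
  by (rule equiv_class_self[OF equiv_null_rel])

lemma cls_eq_of_mem: "a \<in> malg M \<Longrightarrow> A \<in> a \<Longrightarrow> A \<in> sets M \<and> cls A = a"
  by (elim malg_cases) (auto simp: null_rel_iff_AE intro!: equiv_class_eq[OF equiv_null_rel, symmetric])

lemma translate_in_malg: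
  assumes "g \<in> carrier G" "a \<in> malg M"
  shows "translate g a \<in> malg M"
  using assms(2)
proof (rule malg_cases)
  fix A assume "A \<in> sets M" "a = cls A"
  then show ?thesis using assms(1) by (simp add: malg_act_class cls_in_malg pull_sets)
qed

lemma translate_one:
  assumes "a \<in> malg M"
  shows "translate \<one> a = a"
  using assms
proof (rule malg_cases)
  fix A assume A: "A \<in> sets M" "a = cls A"
  have "AE x in M. x \<in> pull \<one> A \<longleftrightarrow> x \<in> A"
    using AE_act_one AE_space by eventually_elim auto
  then show ?thesis
    using A by (simp add: malg_act_class cls_eq_iff pull_sets)
qed

text \<open>
  The inverse in the definition of the action on classes makes this a left action again.
\<close>

lemma translate_mult:
  assumes g: "g \<in> carrier G" and h: "h \<in> carrier G" and "a \<in> malg M"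
  shows "translate (g \<otimes> h) a = translate g (translate h a)"
  using assms(3)
proof (rule malg_cases)
  fix A assume A: "A \<in> sets M" "a = cls A"
  have "AE x in M. x \<in> pull (inv h \<otimes> inv g) A \<longleftrightarrow> x \<in> pull (inv g) (pull (inv h) A)"
    using g h by (intro AE_pull_mult) auto
  then have "cls (pull (inv h \<otimes> inv g) A) = cls (pull (inv g) (pull (inv h) A))"
    using A g h by (intro cls_eq_iff[THEN iffD2] pull_sets) auto
  then show ?thesis
    using A g h by (simp add: malg_act_class pull_sets inv_mult_group)
qed

text \<open>
  Equivalently, the class is fixed by an open subgroup. Openness of all fibres of the orbit
  map is the form in which this is used for countability of orbits and for measurability.
\<close>

definition smooth :: "'a set set \<Rightarrow> bool" where
  "smooth a \<longleftrightarrow> a \<in> malg M \<and> (\<forall>b. openin T {g \<in> carrier G. translate g a = b})"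

lemma fixed_by_open_subgroup_imp_smooth:
  assumes H: "subgroup H G" "openin T H" and a: "a \<in> malg M"
    and fixed: "\<And>h. h \<in> H \<Longrightarrow> translate h a = a"
  shows "smooth a"
proof -
  have "openin T {g \<in> carrier G. translate g a = b}" for b
  proof (subst openin_subopen, intro ballI)
    fix g assume "g \<in> {g \<in> carrier G. translate g a = b}"
    then have g: "g \<in> carrier G" "translate g a = b" by auto
    let ?U = "(\<lambda>h. g \<otimes> h) ` H"
    have "openin T ?U"
      using homeomorphic_left_mult[OF g(1)] H(2) homeomorphic_imp_open_map
      unfolding open_map_def by blast
    moreover have "g \<in> ?U"
      using g(1) subgroup.one_closed[OF H(1)] by (auto intro!: image_eqI[of _ _ \<one>])
    moreover have "?U \<subseteq> {g \<in> carrier G. translate g a = b}"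
      using g a fixed subgroup.mem_carrier[OF H(1)] by (auto simp: translate_mult)
    ultimately show "\<exists>U. openin T U \<and> g \<in> U \<and> U \<subseteq> {g \<in> carrier G. translate g a = b}"
      by (intro exI[of _ ?U] conjI)
  qed
  then show ?thesis using a by (simp add: smooth_def)
qed

lemma smooth_translate:
  assumes g: "g \<in> carrier G" and a: "smooth a"
  shows "smooth (translate g a)"
  unfolding smooth_def
proof (intro conjI allI)
  have am: "a \<in> malg M" using a by (simp add: smooth_def)
  then show "translate g a \<in> malg M" using g by (rule translate_in_malg[rotated])
  fix b
  have "{x \<in> carrier G. translate x (translate g a) = b} =
      {x \<in> carrier G. x \<otimes> g \<in> {y \<in> carrier G. translate y a = b}}"
    using g am by (auto simp: translate_mult)
  also have "openin T \<dots>"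
    using a g by (intro openin_right_mult_vimage) (auto simp: smooth_def)
  finally show "openin T {x \<in> carrier G. translate x (translate g a) = b}" .
qed

text \<open>
  The fibres of the orbit map are open, so a countable dense subset of the group already reaches the whole orbit.
\<close>

lemma countable_orbit:
  assumes "smooth a"
  shows "countable ((\<lambda>g. translate g a) ` carrier G)"
proof -
  obtain Q where Q: "countable Q" "Q \<subseteq> topspace T" "T closure_of Q = topspace T"
    using polish by (auto simp: polish_topology_def separable_space_def)
  have "(\<lambda>g. translate g a) ` carrier G \<subseteq> (\<lambda>g. translate g a) ` Q"
  proof (rule image_subsetI)
    fix g assume g: "g \<in> carrier G"
    let ?U = "{x \<in> carrier G. translate x a = translate g a}"
    have "openin T ?U" using assms by (simp add: smooth_def)
    moreover have "g \<in> ?U" using g by simp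
    moreover have "\<forall>U. g \<in> U \<and> openin T U \<longrightarrow> (\<exists>q. q \<in> Q \<and> q \<in> U)"
      using Q(3) g topspace_eq in_closure_of[of g T Q] by simp
    ultimately have "\<exists>q. q \<in> Q \<and> q \<in> ?U" by (simp only: simp_thms)
    then obtain q where "q \<in> Q" "q \<in> ?U" by (elim exE conjE)
    then show "translate g a \<in> (\<lambda>g. translate g a) ` Q"
      by (intro image_eqI[of _ _ q]) auto
  qed
  then show ?thesis using Q(1) by (rule countable_subset[OF _ countable_image])
qed

lemma smooth_approximation:
  assumes na: "non_archimedean G T" and A: "A \<in> sets M" and "e > 0"
  obtains S where "S \<in> sets M" "smooth (cls S)" "measure M (sym_diff A S) < e"
proof -
  obtain H where H: "subgroup H G" "openin T H"
    and small: "\<And>h. h \<in> H \<Longrightarrow> measure M (sym_diff (pull h A) A) < e / 3"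
    using open_subgroup_small_displacement[OF na A, of "e / 3"] \<open>e > 0\<close> by auto
  obtain S where S: "S \<in> sets M" "measure M (sym_diff A S) \<le> 2 * (e / 3)"
    and inv: "\<And>h. h \<in> H \<Longrightarrow> AE x in M. x \<in> pull h S \<longleftrightarrow> x \<in> S"
    by (rule invariant_approximation[OF H(1) A less_imp_le[OF small]]) auto
  have "translate h (cls S) = cls S" if "h \<in> H" for h
    using inv[OF subgroup.m_inv_closed[OF H(1) that]] subgroup.mem_carrier[OF H(1) that] S(1)
    by (simp add: malg_act_class cls_eq_iff pull_sets)
  then have "smooth (cls S)"
    using H S(1) by (intro fixed_by_open_subgroup_imp_smooth[of H]) (auto intro: cls_in_malg)
  then show thesis using S \<open>e > 0\<close> by (intro that[of S]) auto
qed

lemma countable_invariant_dense_family: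
  assumes na: "non_archimedean G T"
  obtains B where "countable B" "\<And>b. b \<in> B \<Longrightarrow> smooth b"
    "\<And>g b. g \<in> carrier G \<Longrightarrow> b \<in> B \<Longrightarrow> translate g b \<in> B"
    "\<And>A e. A \<in> sets M \<Longrightarrow> e > 0 \<Longrightarrow> \<exists>S\<in>sets M. cls S \<in> B \<and> measure M (sym_diff A S) < e"
proof -
  obtain D :: "nat \<Rightarrow> 'a set" where D: "range D \<subseteq> sets M"
    and dense: "\<And>A e. A \<in> sets M \<Longrightarrow> e > 0 \<Longrightarrow> \<exists>n. measure M (sym_diff A (D n)) < e"
    by (rule separable_measure_algebra) auto
  have D_sets: "D n \<in> sets M" for n using D by auto
  have "\<exists>S\<in>sets M. smooth (cls S) \<and> measure M (sym_diff (D n) S) < inverse (Suc k)" for n k :: nat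
    by (rule smooth_approximation[OF na D_sets[of n], of "inverse (Suc k)"]) auto
  then obtain S where S: "\<And>n k. S n k \<in> sets M" "\<And>n k. smooth (cls (S n k))"
    "\<And>n k. measure M (sym_diff (D n) (S n k)) < inverse (Suc k)"
    by metis
  define B where "B = (\<Union>n. \<Union>k. (\<lambda>g. translate g (cls (S n k))) ` carrier G)"
  show thesis
  proof (rule that[of B])
    show "countable B"
      unfolding B_def using S(2) by (intro countable_UN countable_orbit) auto
    show "smooth b" if "b \<in> B" for b
      using that S(2) by (auto simp: B_def intro: smooth_translate)
    show "translate g b \<in> B" if g: "g \<in> carrier G" and b: "b \<in> B" for g b
    proof -
      obtain n k h where h: "h \<in> carrier G" "b = translate h (cls (S n k))"
        using b by (auto simp: B_def)
      then have "translate g b = translate (g \<otimes> h) (cls (S n k))"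
        using g S(1) by (simp add: translate_mult cls_in_malg)
      then show ?thesis using g h(1) by (auto simp: B_def)
    qed
    show "\<exists>S\<in>sets M. cls S \<in> B \<and> measure M (sym_diff A S) < e" if A: "A \<in> sets M" and e: "e > 0" for A e
    proof -
      obtain n where n: "measure M (sym_diff A (D n)) < e / 2"
        using dense[OF A, of "e / 2"] e by auto
      obtain k where k: "inverse (real (Suc k)) < e / 2"
        using reals_Archimedean[of "e / 2"] e by auto
      have "measure M (sym_diff A (S n k)) \<le> measure M (sym_diff A (D n)) + measure M (sym_diff (D n) (S n k))"
        using A D_sets S(1) by (rule measure_sym_diff_triangle)
      also have "\<dots> < e" using n k S(3)[of n k] by linarith
      finally have "measure M (sym_diff A (S n k)) < e" .
      moreover have "cls (S n k) \<in> B"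
        using translate_one[OF cls_in_malg[OF S(1)], of n k] by (force simp: B_def)
      ultimately show ?thesis using S(1)[of n k] by (intro bexI[of _ "S n k"] conjI)
    qed
  qed
qed

end

section \<open>The model on the Cantor space\<close>

text \<open>
  A measure preserving map induces an embedding of measure algebras by preimages; \<open>onto\<close>
  says that it is surjective, and \<open>\<Phi>\<close> is its inverse.
\<close>

lemma malg_iso_of_pullback:
  assumes \<pi> [measurable]: "\<pi> \<in> M \<rightarrow>\<^sub>M N" and N: "distr M N \<pi> = N"
    and onto: "\<forall>A\<in>sets M. \<exists>C\<in>sets N. AE x in M. x \<in> A \<longleftrightarrow> \<pi> x \<in> C"
    and \<Phi>_def: "\<And>a. \<Phi> a = {C \<in> sets N. \<pi> -` C \<inter> space M \<in> a}"
  shows "malg_iso M N \<Phi>"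
    and "\<And>C. C \<in> sets N \<Longrightarrow> \<Phi> (null_rel M `` {\<pi> -` C \<inter> space M}) = null_rel N `` {C}"
    and "\<And>a. a \<in> malg M \<Longrightarrow> \<exists>C\<in>sets N. a = null_rel M `` {\<pi> -` C \<inter> space M}"
proof -
  let ?p = "\<lambda>C. \<pi> -` C \<inter> space M"
  let ?m = "\<lambda>A. null_rel M `` {A}" and ?n = "\<lambda>C. null_rel N `` {C}"
  have p_sets: "?p C \<in> sets M" if "C \<in> sets N" for C
    using \<pi> that by (rule measurable_sets)
  have pull_iff: "(?p C, ?p D) \<in> null_rel M \<longleftrightarrow> (C, D) \<in> null_rel N"
    if C [measurable]: "C \<in> sets N" and D [measurable]: "D \<in> sets N" for C D
  proof -
    have "(AE y in N. y \<in> C \<longleftrightarrow> y \<in> D) \<longleftrightarrow> (AE x in M. \<pi> x \<in> C \<longleftrightarrow> \<pi> x \<in> D)"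
      by (subst N[symmetric], subst AE_distr_iff[OF \<pi>]) auto
    also have "\<dots> \<longleftrightarrow> (AE x in M. x \<in> ?p C \<longleftrightarrow> x \<in> ?p D)"
      by (intro AE_cong) auto
    finally show ?thesis using that p_sets by (simp add: null_rel_iff_AE)
  qed
  show val: "\<Phi> (?m (?p C)) = ?n C" if C: "C \<in> sets N" for C
  proof (rule Set.set_eqI)
    fix D
    have "D \<in> \<Phi> (?m (?p C)) \<longleftrightarrow> D \<in> sets N \<and> (?p C, ?p D) \<in> null_rel M"
      by (simp add: \<Phi>_def)
    also have "\<dots> \<longleftrightarrow> (C, D) \<in> null_rel N"
      using pull_iff[OF C, of D] by (cases "D \<in> sets N") (simp_all add: null_rel_def)
    finally show "D \<in> \<Phi> (?m (?p C)) \<longleftrightarrow> D \<in> ?n C" by simp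
  qed
  show rep: "\<exists>C\<in>sets N. a = ?m (?p C)" if a: "a \<in> malg M" for a
  proof -
    obtain A where A: "A \<in> sets M" "a = ?m A" using a unfolding malg_def by (rule quotientE)
    obtain C where C: "C \<in> sets N" "AE x in M. x \<in> A \<longleftrightarrow> \<pi> x \<in> C" using onto A(1) by auto
    have "AE x in M. x \<in> A \<longleftrightarrow> x \<in> ?p C"
      using C(2) AE_space by eventually_elim auto
    then have "(A, ?p C) \<in> null_rel M" using A(1) C(1) p_sets by (simp add: null_rel_iff_AE)
    then have "?m A = ?m (?p C)" by (rule equiv_class_eq[OF equiv_null_rel])
    then show ?thesis using A(2) C(1) by auto
  qed
  have class_eq: "?m (?p C) = ?m (?p D) \<longleftrightarrow> ?n C = ?n D" if "C \<in> sets N" "D \<in> sets N" for C D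
    using that p_sets pull_iff
    by (simp add: eq_equiv_class_iff[OF equiv_null_rel])
  show "malg_iso M N \<Phi>"
    unfolding malg_iso_def
  proof (intro conjI ballI)
    show "bij_betw \<Phi> (malg M) (malg N)"
    proof (rule bij_betwI')
      fix a b assume "a \<in> malg M" "b \<in> malg M"
      then obtain C D where CD: "C \<in> sets N" "a = ?m (?p C)" "D \<in> sets N" "b = ?m (?p D)"
        using rep by metis
      show "\<Phi> a = \<Phi> b \<longleftrightarrow> a = b"
        unfolding CD(2,4) by (simp only: val[OF CD(1)] val[OF CD(3)] class_eq[OF CD(1,3)])
    next
      fix a assume "a \<in> malg M"
      then obtain C where C: "C \<in> sets N" "a = ?m (?p C)" using rep by metis
      then show "\<Phi> a \<in> malg N" by (simp add: val malg_def quotientI)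
    next
      fix c assume "c \<in> malg N"
      then obtain C where C: "C \<in> sets N" "c = ?n C" unfolding malg_def by (rule quotientE)
      then show "\<exists>a\<in>malg M. c = \<Phi> a"
        using val[OF C(1)] p_sets[OF C(1)] by (intro bexI[of _ "?m (?p C)"]) (auto simp: malg_def quotientI)
    qed
    fix a assume "a \<in> malg M"
    then obtain C where C: "C \<in> sets N" "a = ?m (?p C)" using rep by metis
    have "?p (space N - C) = space M - ?p C"
      using measurable_space[OF \<pi>] by auto
    then have "malg_compl M a = ?m (?p (space N - C))"
      using C p_sets by (simp add: malg_compl_class)
    then show "\<Phi> (malg_compl M a) = malg_compl N (\<Phi> a)"
      using C val[OF sets.compl_sets[OF C(1)]] by (simp add: val malg_compl_class)
    have "emeasure N C = emeasure M (?p C)"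
      using emeasure_distr[OF \<pi> C(1)] N by simp
    then show "malg_measure N (\<Phi> a) = malg_measure M a"
      using C p_sets by (simp add: val malg_measure_class)
    fix b assume "b \<in> malg M"
    then obtain D where D: "D \<in> sets N" "b = ?m (?p D)" using rep by metis
    have "?p C \<inter> ?p D = ?p (C \<inter> D)" by auto
    then have "malg_inf M a b = ?m (?p (C \<inter> D))"
      using C D p_sets by (simp add: malg_inf_class)
    then have "\<Phi> (malg_inf M a b) = ?n (C \<inter> D)"
      by (simp only: val[OF sets.Int[OF C(1) D(1)]])
    then show "\<Phi> (malg_inf M a b) = malg_inf N (\<Phi> a) (\<Phi> b)"
      using C D by (simp add: val malg_inf_class)
  qed
qed

instance bool :: second_countable_topology
proof
  show "\<exists>B :: bool set set. countable B \<and> open = generate_topology B"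
    by (intro exI[of _ "range lessThan \<union> range greaterThan"]) (auto simp: open_bool_def)
qed

definition cantor :: "(nat \<Rightarrow> bool) measure" where
  "cantor = Pi\<^sub>M UNIV (\<lambda>_. count_space UNIV)"

lemma space_cantor: "space cantor = UNIV"
  by (simp add: cantor_def space_PiM)

lemma measurable_coordinate: "(\<lambda>y. y n) \<in> cantor \<rightarrow>\<^sub>M count_space UNIV"
  unfolding cantor_def by (rule measurable_component_singleton) simp

lemma measurable_into_cantor:
  assumes "\<And>n. (\<lambda>x. f x n) \<in> M \<rightarrow>\<^sub>M count_space UNIV"
  shows "f \<in> M \<rightarrow>\<^sub>M cantor"
  unfolding cantor_def by (rule measurable_PiM_single') (use assms in \<open>auto simp: extensional_def\<close>)

lemma standard_borel_cantor:
  assumes "sets N = sets cantor"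
  shows "standard_borel N"
proof -
  let ?S = "product_topology (\<lambda>_. discrete_topology (UNIV :: bool set)) (UNIV :: nat set)"
  have "discrete_topology (UNIV :: bool set) = euclidean"
    by (subst discrete_topology_unique) (auto intro: discrete_topology_class.open_discrete)
  then have S: "?S = (euclidean :: (nat \<Rightarrow> bool) topology)"
    by (simp add: euclidean_product_topology)
  have "\<exists>D :: (nat \<Rightarrow> bool) set. countable D \<and> (\<forall>U. open U \<longrightarrow> U \<noteq> {} \<longrightarrow> (\<exists>d\<in>D. d \<in> U))"
    by (rule countable_dense_exists)
  then obtain D :: "(nat \<Rightarrow> bool) set" where D: "countable D"
    "\<forall>U. open U \<longrightarrow> U \<noteq> {} \<longrightarrow> (\<exists>d\<in>D. d \<in> U)"
    by (elim exE conjE)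
  have "closure D = UNIV"
  proof (rule ccontr)
    assume "closure D \<noteq> UNIV"
    then obtain d where "d \<in> D" "d \<in> - closure D"
      using D(2)[THEN spec, of "- closure D"] by auto
    then show False using closure_subset[of D] by auto
  qed
  then have "separable_space ?S"
    unfolding S separable_space_def using D(1) by (intro exI[of _ D]) simp
  moreover have "completely_metrizable_space ?S"
    by (simp add: completely_metrizable_space_product_topology completely_metrizable_space_discrete_topology)
  ultimately have "polish_topology ?S" by (simp add: polish_topology_def)
  moreover have "topspace ?S = space N"
    using sets_eq_imp_space_eq[OF assms] by (simp add: space_cantor)
  moreover have "sets N = sets (borel_of ?S)"
  proof -
    have "sets cantor = sets (Pi\<^sub>M UNIV (\<lambda>_::nat. borel :: bool measure))"
      unfolding cantor_def by (intro sets_PiM_cong) (auto simp: sets_borel_eq_count_space)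
    also have "\<dots> = sets (borel :: (nat \<Rightarrow> bool) measure)" by (rule sets_PiM_equal_borel)
    also have "\<dots> = sets (borel_of ?S)"
      unfolding S by (simp add: borel_of_def borel_def)
    finally show ?thesis using assms by simp
  qed
  ultimately show ?thesis unfolding standard_borel_def by (intro exI[of _ ?S] conjI)
qed

context near_action
begin

text \<open>
  The countable invariant family is given here by its coding in the natural numbers: \<open>R n\<close>
  are the representatives and \<open>perm\<close> is the induced action on the indices. The model is the
  image measure under \<open>\<pi>\<close> on the Cantor space, with \<open>G\<close> permuting the coordinates.
\<close>

lemma spatial_model_of_coding:
  fixes R :: "nat \<Rightarrow> 'a set" and perm :: "'g \<Rightarrow> nat \<Rightarrow> nat"
  assumes R [measurable]: "\<And>n. R n \<in> sets M"
    and dense: "\<And>A e. A \<in> sets M \<Longrightarrow> e > 0 \<Longrightarrow> \<exists>n. measure M (sym_diff A (R n)) < e"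
    and perm_one: "\<And>n. perm \<one> n = n"
    and perm_mult: "\<And>g h n. g \<in> carrier G \<Longrightarrow> h \<in> carrier G \<Longrightarrow> perm (g \<otimes> h) n = perm g (perm h n)"
    and perm_open: "\<And>n m. openin T {g \<in> carrier G. perm g n = m}"
    and equivariant: "\<And>g n. g \<in> carrier G \<Longrightarrow> AE x in M. x \<in> pull (inv g) (R n) \<longleftrightarrow> x \<in> R (perm g n)"
  shows "admits_spatial_model G T M act"
proof -
  define \<pi> where "\<pi> x n \<longleftrightarrow> x \<in> R n" for x n
  define N where "N = distr M cantor \<pi>"
  define act' where "act' g y = y \<circ> perm (inv g)" for g and y :: "nat \<Rightarrow> bool"
  have space_T: "space (borel_of T) = carrier G"
    by (simp add: borel_of_def space_measure_of_conv topspace_eq)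
  have \<pi>_meas: "\<pi> \<in> M \<rightarrow>\<^sub>M cantor"
    by (rule measurable_into_cantor) (simp add: \<pi>_def)
  have sets_N: "sets N = sets cantor" by (simp add: N_def)
  have space_N: "space N = UNIV" by (simp add: N_def space_cantor)
  have \<pi>_N: "\<pi> \<in> M \<rightarrow>\<^sub>M N" using \<pi>_meas by (simp add: measurable_cong_sets[OF refl sets_N])
  have N: "distr M N \<pi> = N"
    unfolding N_def by (intro distr_cong) simp_all
  have \<pi>_act: "AE x in M. \<pi> (act g x) = act' g (\<pi> x)" if g: "g \<in> carrier G" for g
  proof -
    have "AE x in M. \<forall>n. x \<in> pull g (R n) \<longleftrightarrow> x \<in> R (perm (inv g) n)"
      using equivariant[OF inv_closed[OF g]] g by (simp add: AE_all_countable)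
    then show ?thesis
      using AE_space by eventually_elim (auto simp: \<pi>_def act'_def fun_eq_iff)
  qed
  have joint: "(\<lambda>(g, y). act' g y) \<in> borel_of T \<Otimes>\<^sub>M N \<rightarrow>\<^sub>M N"
  proof -
    have "(\<lambda>p. act' (fst p) (snd p) n) \<in> borel_of T \<Otimes>\<^sub>M cantor \<rightarrow>\<^sub>M count_space UNIV" for n
    proof -
      have inv_perm: "(\<lambda>g. perm (inv g) n) \<in> borel_of T \<rightarrow>\<^sub>M count_space UNIV"
      proof (subst measurable_count_space_eq2_countable, intro conjI ballI)
        show "(\<lambda>g. perm (inv g) n) -` {m} \<inter> space (borel_of T) \<in> sets (borel_of T)" for m
        proof -
          have "openin T {g \<in> topspace T. inv g \<in> {g \<in> carrier G. perm g n = m}}"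
            by (rule openin_continuous_map_preimage[OF continuous_inv perm_open])
          also have "{g \<in> topspace T. inv g \<in> {g \<in> carrier G. perm g n = m}} =
              (\<lambda>g. perm (inv g) n) -` {m} \<inter> space (borel_of T)"
            by (auto simp: topspace_eq space_T)
          finally show ?thesis
            using openin_subset[of T] by (auto simp: borel_of_def intro!: sigma_sets.Basic)
        qed
      qed auto
      have "(\<lambda>p. snd p m) \<in> borel_of T \<Otimes>\<^sub>M cantor \<rightarrow>\<^sub>M count_space UNIV" for m
        using measurable_compose[OF measurable_snd measurable_coordinate] .
      then have "(\<lambda>p. snd p (perm (inv (fst p)) n)) \<in> borel_of T \<Otimes>\<^sub>M cantor \<rightarrow>\<^sub>M count_space UNIV"
        by (rule measurable_compose_countable[OF _ measurable_compose[OF measurable_fst inv_perm]])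
      then show ?thesis by (simp add: act'_def)
    qed
    then have "(\<lambda>p. act' (fst p) (snd p)) \<in> borel_of T \<Otimes>\<^sub>M cantor \<rightarrow>\<^sub>M cantor"
      by (rule measurable_into_cantor)
    then show ?thesis
      by (simp add: case_prod_beta' measurable_cong_sets[OF sets_pair_measure_cong[OF refl sets_N] sets_N])
  qed
  have act'_meas: "act' g \<in> N \<rightarrow>\<^sub>M N" if "g \<in> carrier G" for g
    using measurable_section[OF joint] that by (simp add: topspace_eq)
  have preserves: "distr N N (act' g) = N" if g: "g \<in> carrier G" for g
  proof -
    have "distr N N (act' g) = distr (distr M N \<pi>) N (act' g)"
      by (simp only: N)
    also have "\<dots> = distr M N (act' g \<circ> \<pi>)"
      using act'_meas[OF g] \<pi>_N by (rule distr_distr)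
    also have "\<dots> = distr M N (\<pi> \<circ> act g)"
      using \<pi>_act[OF g] measurable_comp[OF \<pi>_N act'_meas[OF g]] measurable_comp[OF measurable_act[OF g] \<pi>_N]
      by (intro distr_cong_AE) (auto elim: AE_mp)
    also have "\<dots> = distr (distr M M (act g)) N \<pi>"
      using distr_distr[OF \<pi>_N measurable_act[OF g]] by simp
    also have "\<dots> = N"
      by (simp only: act_preserves[OF g] N)
    finally show ?thesis .
  qed
  have "prob_space N"
    unfolding N_def using \<pi>_meas by (rule prob_space_distr)
  then interpret N: standard_borel_prob_space N
    using standard_borel_cantor[OF sets_N]
    by (intro standard_borel_prob_space.intro standard_borel_prob_space_axioms.intro)
  interpret N: spatial_action G T N act'
  proof
    show "act' \<one> y = y" for y
      by (simp add: act'_def perm_one fun_eq_iff)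
    show "act' g (act' h y) = act' (g \<otimes> h) y" if "g \<in> carrier G" "h \<in> carrier G" for g h y
      using that by (simp add: act'_def fun_eq_iff inv_mult_group perm_mult)
  qed (fact joint preserves)+
  have onto: "\<forall>A\<in>sets M. \<exists>C\<in>sets N. AE x in M. x \<in> A \<longleftrightarrow> \<pi> x \<in> C"
  proof
    fix A assume A [measurable]: "A \<in> sets M"
    have "\<exists>n. measure M (sym_diff A (R n)) < (1/2)^k" for k :: nat
      using dense[OF A, of "(1/2)^k"] by simp
    then obtain n where n: "\<And>k. measure M (sym_diff A (R (n k))) < (1/2)^k" by metis
    \<comment> \<open>the errors of the approximations \<open>R (n k)\<close> are summable, so almost every point is misplaced by finitely many of them\<close>
    define C where "C = {y :: nat \<Rightarrow> bool. \<forall>\<^sub>F k in sequentially. y (n k)}"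
    have "AE x in M. \<forall>\<^sub>F k in sequentially. x \<in> space M - sym_diff A (R (n k))"
    proof (rule borel_cantelli_AE1)
      show "summable (\<lambda>k. measure M (sym_diff A (R (n k))))"
        by (rule summable_comparison_test'[of "\<lambda>k. (1/2)^k" 0])
          (use n in \<open>auto intro: less_imp_le summable_geometric\<close>)
      show "sym_diff A (R (n k)) \<in> sets M" for k by measurable
    qed (simp add: emeasure_eq_measure)
    then have "AE x in M. x \<in> A \<longleftrightarrow> \<pi> x \<in> C"
    proof eventually_elim
      case (elim x)
      then have "\<forall>\<^sub>F k in sequentially. x \<in> A \<longleftrightarrow> \<pi> x (n k)"
        by (rule eventually_mono) (auto simp: \<pi>_def)
      then have "(\<forall>\<^sub>F k in sequentially. x \<in> A) \<longleftrightarrow> (\<forall>\<^sub>F k in sequentially. \<pi> x (n k))"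
        by (rule eventually_cong)
      then show ?case by (simp add: C_def)
    qed
    moreover have "C \<in> sets N"
    proof -
      note [measurable] = measurable_coordinate
      have "{y \<in> space cantor. \<forall>\<^sub>F k in sequentially. y (n k)} \<in> sets cantor"
        by measurable
      then show ?thesis by (simp add: C_def space_cantor sets_N)
    qed
    ultimately show "\<exists>C\<in>sets N. AE x in M. x \<in> A \<longleftrightarrow> \<pi> x \<in> C" by auto
  qed
  define \<Phi> where "\<Phi> a = {C \<in> sets N. \<pi> -` C \<inter> space M \<in> a}" for a
  note \<Phi> = malg_iso_of_pullback[OF \<pi>_N N onto \<Phi>_def]
  have "\<Phi> (translate g a) = malg_act G N act' g (\<Phi> a)" if g: "g \<in> carrier G" and a: "a \<in> malg M" for g a
  proof -
    obtain C where C: "C \<in> sets N" "a = cls (\<pi> -` C \<inter> space M)" using \<Phi>(3)[OF a] by auto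
    let ?C = "act' (inv g) -` C \<inter> space N"
    have C': "?C \<in> sets N" using act'_meas[OF inv_closed[OF g]] C(1) by (rule measurable_sets)
    note p = measurable_sets[OF \<pi>_N C(1)] measurable_sets[OF \<pi>_N C']
    have "AE x in M. x \<in> pull (inv g) (\<pi> -` C \<inter> space M) \<longleftrightarrow> x \<in> \<pi> -` ?C \<inter> space M"
      using \<pi>_act[OF inv_closed[OF g]] AE_space
      by eventually_elim (use act_in_space[OF inv_closed[OF g]] space_N in auto)
    then have "cls (pull (inv g) (\<pi> -` C \<inter> space M)) = cls (\<pi> -` ?C \<inter> space M)"
      by (rule cls_eq_iff[THEN iffD2, OF pull_sets[OF inv_closed[OF g] p(1)] p(2)])
    then have "translate g a = cls (\<pi> -` ?C \<inter> space M)"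
      unfolding C(2) malg_act_class[OF g p(1)] .
    then have "\<Phi> (translate g a) = null_rel N `` {?C}" by (simp only: \<Phi>(2)[OF C'])
    also have "\<dots> = malg_act G N act' g (null_rel N `` {C})"
      by (rule near_action.malg_act_class[OF N.near_action g C(1), symmetric])
    also have "null_rel N `` {C} = \<Phi> a" by (simp only: C(2) \<Phi>(2)[OF C(1)])
    finally show ?thesis .
  qed
  with \<Phi>(1) have "malg_actions_isomorphic G M act N act'"
    unfolding malg_actions_isomorphic_def by (intro exI[of _ \<Phi>]) simp
  then show ?thesis
    unfolding admits_spatial_model_def
    using N.spatial_action_axioms by (intro exI[of _ N] exI[of _ act'] conjI)
qed

text \<open>
  The family is enumerated by the natural numbers. As it may be finite, indices outside the
  range of the enumeration are fixed by the group and represent the empty set.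
\<close>

lemma non_archimedean_admits_spatial_model:
  assumes na: "non_archimedean G T"
  shows "admits_spatial_model G T M act"
proof -
  obtain B where B: "countable B" and B_smooth: "\<And>b. b \<in> B \<Longrightarrow> smooth b"
    and B_inv: "\<And>g b. g \<in> carrier G \<Longrightarrow> b \<in> B \<Longrightarrow> translate g b \<in> B"
    and B_dense: "\<And>A e. A \<in> sets M \<Longrightarrow> e > 0 \<Longrightarrow> \<exists>S\<in>sets M. cls S \<in> B \<and> measure M (sym_diff A S) < e"
    by (rule countable_invariant_dense_family[OF na]) (rule that)
  have B_malg: "b \<in> malg M" if "b \<in> B" for b
    using B_smooth[OF that] by (simp add: smooth_def)
  define c where "c = to_nat_on B"
  have c_inj: "c a = c b \<longleftrightarrow> a = b" if "a \<in> B" "b \<in> B" for a b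
    using B that by (simp add: c_def)
  define R where "R n = (if n \<in> c ` B then SOME S. S \<in> from_nat_into B n else {})" for n
  define perm where "perm g n = (if n \<in> c ` B then c (translate g (from_nat_into B n)) else n)" for g n
  have decode: "from_nat_into B (c b) = b" if "b \<in> B" for b
    using B that by (simp add: c_def)
  have R_code: "R (c b) \<in> sets M \<and> cls (R (c b)) = b" if b: "b \<in> B" for b
  proof -
    obtain A where "A \<in> sets M" "b = cls A" using B_malg[OF b] by (rule malg_cases)
    then have "\<exists>S. S \<in> b" using cls_self by auto
    then have "R (c b) \<in> b" using b by (simp add: R_def decode some_in_eq ex_in_conv)
    then show ?thesis by (rule cls_eq_of_mem[OF B_malg[OF b]])
  qed
  have perm_code: "perm g (c b) = c (translate g b)" if "b \<in> B" for g b
    using that by (simp add: perm_def decode)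
  have perm_other: "perm g n = n" if "n \<notin> c ` B" for g n
    using that by (simp add: perm_def)
  have R_sets: "R n \<in> sets M" for n
    using R_code by (cases "n \<in> c ` B") (auto simp: R_def)
  show ?thesis
  proof (rule spatial_model_of_coding[of R perm, OF R_sets])
    show "\<exists>n. measure M (sym_diff A (R n)) < e" if A: "A \<in> sets M" and "e > 0" for A e
    proof -
      obtain S where S: "S \<in> sets M" "cls S \<in> B" "measure M (sym_diff A S) < e"
        using B_dense[OF A \<open>e > 0\<close>] by auto
      have "AE x in M. x \<in> S \<longleftrightarrow> x \<in> R (c (cls S))"
        using R_code[OF S(2)] S(1) by (intro cls_eq_iff[THEN iffD1]) auto
      then have "measure M (sym_diff S A) = measure M (sym_diff (R (c (cls S))) A)"
        using S(1) R_sets A by (rule measure_sym_diff_cong)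
      then show ?thesis using S(3) by (intro exI[of _ "c (cls S)"]) (simp add: Un_commute)
    qed
    show "perm \<one> n = n" for n
      by (cases "n \<in> c ` B") (auto simp: perm_code perm_other translate_one B_malg)
    show "perm (g \<otimes> h) n = perm g (perm h n)" if "g \<in> carrier G" "h \<in> carrier G" for g h n
      using that by (cases "n \<in> c ` B") (auto simp: perm_code perm_other translate_mult B_malg B_inv)
    show "openin T {g \<in> carrier G. perm g n = m}" for n m
    proof (cases "n \<in> c ` B")
      case False
      then have "{g \<in> carrier G. perm g n = m} = (if n = m then topspace T else {})"
        by (auto simp: perm_other topspace_eq)
      then show ?thesis by simp
    next
      case True
      then obtain b where b: "b \<in> B" "n = c b" by auto
      show ?thesis
      proof (cases "m \<in> c ` B")
        case True
        then obtain d where d: "d \<in> B" "m = c d" by auto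
        have "{g \<in> carrier G. perm g n = m} = {g \<in> carrier G. translate g b = d}"
          using b d by (auto simp: perm_code c_inj B_inv)
        then show ?thesis using B_smooth[OF b(1)] by (simp add: smooth_def)
      next
        case False
        then have "{g \<in> carrier G. perm g n = m} = {}"
          using b by (auto simp: perm_code B_inv)
        then show ?thesis by (simp only: openin_empty)
      qed
    qed
    show "AE x in M. x \<in> pull (inv g) (R n) \<longleftrightarrow> x \<in> R (perm g n)" if g: "g \<in> carrier G" for g n
    proof (cases "n \<in> c ` B")
      case False
      then show ?thesis by (simp add: perm_other R_def)
    next
      case True
      then obtain b where b: "b \<in> B" "n = c b" by auto
      have "cls (pull (inv g) (R n)) = translate g b"
        using malg_act_class[OF g R_sets[of n]] R_code[OF b(1)] b(2) by simp
      also have "\<dots> = cls (R (perm g n))"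
        using R_code[OF B_inv[OF g b(1)]] b by (simp add: perm_code)
      finally show ?thesis
        using g R_sets by (intro cls_eq_iff[THEN iffD1]) (auto intro: pull_sets)
    qed
  qed
qed

end

theorem theorem4p3:
  fixes G :: "('g, 'm) monoid_scheme" and T :: "'g topology"
    and M :: "'a measure" and act :: "'g \<Rightarrow> 'a \<Rightarrow> 'a"
  assumes "polish_group G T"
    and "non_archimedean G T"
    and "near_action G T M act"
  shows "admits_spatial_model G T M act"
  using assms(3,2) by (rule near_action.non_archimedean_admits_spatial_model)

end
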